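(* For positive integers $a$ and $n$ let $$R(n;a)=\#\left\{(x,y)\in\mathbb{N}^2:\ \frac{a}{n}=\frac1x+\frac1y\right\},$$ for $N\ge1$ let $S(N;a)=\sum_{n\le N,\,(n,a)=1}R(n;a)$, and let $$U(N)=\sum_{a\in\mathbb{N}}S(N;a).$$ Then, for $N\ge 2$, $$U(N)=\frac14 C N(\log N)^3+O\big(N(\log N)^2\big),\qquad\text{where } C=\prod_p\left(1-3p^{-2}+2p^{-3}\right),$$ the product being over all primes $p$.
   Context: $\mathbb{N}$ denotes the positive integers. The sum defining $U(N)$ is finite since $R(n;a)=0$ whenever $a>2n$. *)

theory Defs
  imports "HOL-Analysis.Analysis" "HOL-Computational_Algebra.Primes"
begin

definition R :: "nat \<Rightarrow> nat \<Rightarrow> nat" where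
  "R n a = card {(x :: nat, y :: nat). x \<ge> 1 \<and> y \<ge> 1 \<and>
      (of_nat a / of_nat n :: rat) = 1 / of_nat x + 1 / of_nat y}"

definition S :: "nat \<Rightarrow> nat \<Rightarrow> nat" where
  "S N a = (\<Sum>n \<in> {n. 1 \<le> n \<and> n \<le> N \<and> coprime n a}. R n a)"

definition U :: "nat \<Rightarrow> real" where
  "U N = infsum (\<lambda>a. real (S N a)) {1..}"

definition C_const :: real where
  "C_const = (\<Prod>p. if prime p then 1 - 3 / real p ^ 2 + 2 / real p ^ 3 else 1)"

end

theory Submission
  imports Defs
begin


text \<open>
  Write \<open>x = g e u\<close>, \<open>y = g e v\<close> with \<open>u, v\<close> coprime and \<open>u + v = a g\<close>. If \<open>a / n\<close> is in lowest terms and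
  equals \<open>1 / x + 1 / y\<close>, then \<open>n = u v e\<close>. Hence \<open>U N\<close> counts the quadruples \<open>(u, v, e, a)\<close> with
  \<open>u v e \<le> N\<close>, \<open>a\<close> dividing \<open>u + v\<close>, and \<open>u, v\<close> as well as \<open>a, e\<close> coprime. By symmetry take \<open>u < v\<close> and
  put \<open>u + v = a b\<close>; the coprimality conditions become those for the pairs \<open>(u, a)\<close>, \<open>(u, b)\<close>, \<open>(a, e)\<close>.

  Inclusion-exclusion over sets of primes removes these three conditions and leaves counts in
  which \<open>u, a, b, e\<close> are multiples of \<open>\<alpha>, \<beta>, \<gamma>, \<delta>\<close>. For fixed \<open>u, e\<close> the pairs \<open>(a, b)\<close> lie between two
  hyperbolas, and \<open>\<Sum>n\<le>x. d(n) = x log x + O(x)\<close> suffices. As \<open>u < v\<close> forces \<open>u\<^sup>2 e \<le> N\<close>, with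
  \<open>P = \<alpha> \<beta> \<gamma> \<delta>\<close> the count is \<open>N (log N)^3 / (8 P)\<close> up to \<open>O(N (log N)\<^sup>2 (1 + log P) / P)\<close>, uniformly.
  The signed sum of \<open>1 / P\<close> is the partial Euler product of \<open>C\<close>, and the error terms form a convergent sum.
\<close>

section \<open>Logarithmic sums\<close>

lemma inverse_le_ln_diff:
  assumes "x > (0::real)"
  shows "1 / (x + 1) \<le> ln (x + 1) - ln x"
  using assms ln_le_minus_one[of "x / (x + 1)"] by (simp add: ln_div field_simps)

lemma harm_le_one_plus_ln:
  assumes "n \<ge> 1"
  shows "(harm n :: real) \<le> 1 + ln (real n)"
  using assms
proof (induction n rule: dec_induct)
  case base
  then show ?case by (simp add: harm_def)
next
  case (step n)
  then show ?case
    using inverse_le_ln_diff[of "real n"]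
    by (simp add: harm_Suc inverse_eq_divide add.commute)
qed

lemma abs_harm_minus_ln_le:
  assumes "n \<ge> 1"
  shows "\<bar>harm n - ln (real n)\<bar> \<le> 1"
proof -
  have "ln (real n) \<le> ln (real n + 1)"
    using assms by simp
  then show ?thesis
    using harm_le_one_plus_ln[OF assms] ln_le_harm[of n] by linarith
qed

lemma abs_sum_ln_div_le:
  assumes "n \<ge> 1"
  shows "\<bar>(\<Sum>k=1..n. ln (real k) / real k) - (ln (real n))\<^sup>2 / 2\<bar> \<le> 1 + ln (real n)"
proof -
  \<comment> \<open>The increment of \<open>(ln x)^2 / 2\<close> from \<open>n\<close> to
    \<open>n + 1\<close> differs from the new summand by at most \<open>1 / (n + 1)\<close>, so the
    induction carries the harmonic number as its error bound.\<close>
  have "\<bar>(\<Sum>k=1..n. ln (real k) / real k) - (ln (real n))\<^sup>2 / 2\<bar> \<le> harm n"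
    using assms
  proof (induction n rule: dec_induct)
    case base
    then show ?case by (simp add: harm_def)
  next
    case (step n)
    define x where "x = real n"
    define d where "d = ln (x + 1) - ln x"
    have x: "x \<ge> 1" using step by (simp add: x_def)
    have lo: "1 / (x + 1) \<le> d"
      using inverse_le_ln_diff[of x] x by (simp add: d_def)
    have hi: "d \<le> 1 / x"
      using ln_add_one_self_le_self[of "1 / x"] x ln_div[of "x + 1" x]
      by (simp add: d_def add_divide_distrib)
    have lnx: "0 \<le> ln x" "ln (x + 1) \<le> x" "0 \<le> ln (x + 1)"
      using x ln_add_one_self_le_self[of x] by (simp_all add: add.commute)
    have "ln (x + 1) / (x + 1) - 1 / (x + 1) \<le> ((ln (x + 1))\<^sup>2 - (ln x)\<^sup>2) / 2 
      \<and> ((ln (x + 1))\<^sup>2 - (ln x)\<^sup>2) / 2 \<le> ln (x + 1) / (x + 1) + 1 / (x + 1)"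
    proof
      \<comment> \<open>A difference of two squares, where \<open>d\<close> lies between
        \<open>1 / (x + 1)\<close> and \<open>1 / x\<close>: \<open>d * ln (x + 1)\<close> exceeds
        the new summand by at most \<open>1 / (x + 1)\<close>, and so does \<open>d * d / 2\<close>
        exceed zero.\<close>
      have eq: "((ln (x + 1))\<^sup>2 - (ln x)\<^sup>2) / 2 = d * ln (x + 1) - d * d / 2"
        by (simp add: d_def power2_eq_square field_simps)
      have inv: "1 / x = 1 / (x + 1) + 1 / (x * (x + 1))"
        using x by (simp add: divide_simps)
      have "d * ln (x + 1) \<le> 1 / x * ln (x + 1)"
        using hi lnx by (intro mult_right_mono) auto
      also have "\<dots> = ln (x + 1) / (x + 1) + ln (x + 1) / (x * (x + 1))"
        by (simp only: inv distrib_right times_divide_eq_left mult_1)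
      also have "ln (x + 1) / (x * (x + 1)) \<le> x / (x * (x + 1))"
        using lnx x by (intro divide_right_mono) auto
      also have "\<dots> = 1 / (x + 1)" using x by simp
      finally show "((ln (x + 1))\<^sup>2 - (ln x)\<^sup>2) / 2 \<le> ln (x + 1) / (x + 1) + 1 / (x + 1)"
        using eq zero_le_square[of d] by linarith
      have d: "0 \<le> d" using lo x by (smt (verit) divide_nonneg_nonneg)
      have "ln (x + 1) / (x + 1) \<le> d * ln (x + 1)"
        using mult_right_mono[OF lo lnx(3)] by simp
      moreover have "d * d \<le> 2 / (x + 1)"
      proof -
        have "d * d \<le> 1 / x * (1 / x)" using hi d x by (intro mult_mono) auto
        also have "\<dots> \<le> 2 / (x + 1)"
        proof -
          have "x + 1 \<le> x * x * 2" using x mult_left_mono[of 1 x x] by linarith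
          then show ?thesis using x by (simp add: field_simps)
        qed
        finally show ?thesis .
      qed
      ultimately show "ln (x + 1) / (x + 1) - 1 / (x + 1) \<le> ((ln (x + 1))\<^sup>2 - (ln x)\<^sup>2) / 2"
        using eq by linarith
    qed
    moreover have sum: "(\<Sum>k=1..Suc n. ln (real k) / real k)
        = (\<Sum>k=1..n. ln (real k) / real k) + ln (x + 1) / (x + 1)"
      by (simp add: x_def add.commute)
    moreover have harm: "(harm (Suc n) :: real) = harm n + 1 / (x + 1)"
      by (simp add: harm_Suc x_def inverse_eq_divide add.commute)
    moreover have Suc: "real (Suc n) = x + 1" by (simp add: x_def)
    ultimately show ?case
      using step.IH
      unfolding sum harm Suc x_def[symmetric] diff_divide_distrib abs_le_iff
      by (intro conjI; linarith)
  qed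
  then show ?thesis
    using harm_le_one_plus_ln[OF assms] by linarith
qed


section \<open>Lattice points under a hyperbola: the summatory divisor function\<close>

definition hyperbola_points :: "real \<Rightarrow> (nat \<times> nat) set" where
  "hyperbola_points x = {(a, b). 0 < a \<and> 0 < b \<and> real (a * b) \<le> x}"

lemma hyperbola_points_eq:
  assumes "x > 0"
  shows "hyperbola_points x = (SIGMA a:{1..nat \<lfloor>x\<rfloor>}. {1..nat \<lfloor>x / real a\<rfloor>})"
proof -
  have "0 < a \<and> 0 < b \<and> real (a * b) \<le> x \<longleftrightarrow> a \<in> {1..nat \<lfloor>x\<rfloor>} \<and> b \<in> {1..nat \<lfloor>x / real a\<rfloor>}" for a b :: nat
  proof
    assume h: "0 < a \<and> 0 < b \<and> real (a * b) \<le> x"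
    then have "real a * 1 \<le> real a * real b" by (intro mult_left_mono) auto
    with h have "real a \<le> x" unfolding of_nat_mult by linarith
    moreover have "real b \<le> x / real a" using h by (simp add: field_simps)
    ultimately show "a \<in> {1..nat \<lfloor>x\<rfloor>} \<and> b \<in> {1..nat \<lfloor>x / real a\<rfloor>}"
      using h by (simp add: le_nat_floor)
  next
    assume h: "a \<in> {1..nat \<lfloor>x\<rfloor>} \<and> b \<in> {1..nat \<lfloor>x / real a\<rfloor>}"
    then have "int b \<le> \<lfloor>x / real a\<rfloor>" by auto
    then have "real b \<le> x / real a" by linarith
    with h show "0 < a \<and> 0 < b \<and> real (a * b) \<le> x" by (simp add: field_simps)
  qed
  then show ?thesis by (auto simp: hyperbola_points_def)
qed

lemma finite_hyperbola_points: "finite (hyperbola_points x)"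
proof (cases "x > 0")
  case True
  then show ?thesis by (simp add: hyperbola_points_eq)
next
  case False
  have "\<not> real (a * b) \<le> x" if "0 < a" "0 < b" for a b
  proof -
    have "0 < real (a * b)" using that by simp
    then show ?thesis using False by linarith
  qed
  then have "hyperbola_points x = {}" by (auto simp: hyperbola_points_def)
  then show ?thesis by simp
qed

text \<open>For each \<open>a \<le> x\<close> the floor of \<open>x / a\<close> loses less than 1,
  so the total loss is at most \<open>x\<close>, and what remains is \<open>x\<close> times a
  harmonic number. For \<open>x < 1\<close> there are no points, and \<open>max 1 x\<close> makes
  the main term vanish too; this range occurs when the moduli are large.\<close>

lemma abs_card_hyperbola_points_le:
  assumes "x > 0"
  shows "\<bar>real (card (hyperbola_points x)) - x * ln (max 1 x)\<bar> \<le> x"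
proof (cases "x \<ge> 1")
  case False
  then have "nat \<lfloor>x\<rfloor> = 0" using assms by (simp add: floor_less_iff)
  then show ?thesis using False assms by (simp add: hyperbola_points_eq)
next
  case True
  define m where "m = nat \<lfloor>x\<rfloor>"
  have m: "m \<ge> 1" "real m \<le> x" "x < real m + 1"
    using True by (simp_all add: m_def le_nat_iff)
  have card: "real (card (hyperbola_points x)) = (\<Sum>a=1..m. real (nat \<lfloor>x / real a\<rfloor>))"
    using assms by (simp add: hyperbola_points_eq m_def)
  have xh: "(\<Sum>a=1..m. x / real a) = x * harm m"
    by (simp add: harm_def sum_distrib_left divide_inverse)
  have "(\<Sum>a=1..m. real (nat \<lfloor>x / real a\<rfloor>)) \<le> (\<Sum>a=1..m. x / real a)"
    using assms by (intro sum_mono) auto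
  moreover have "(\<Sum>a=1..m. x / real a - 1) \<le> (\<Sum>a=1..m. real (nat \<lfloor>x / real a\<rfloor>))"
    using assms by (intro sum_mono) linarith
  then have "x * harm m - real m \<le> (\<Sum>a=1..m. real (nat \<lfloor>x / real a\<rfloor>))"
    unfolding sum_subtractf xh by simp
  moreover have "x * ln x \<le> x * harm m"
  proof -
    have "ln x \<le> ln (real m + 1)" using m True by simp
    then have "ln x \<le> harm m" using ln_le_harm[of m] by linarith
    then show ?thesis using True by (intro mult_left_mono) auto
  qed
  moreover have "x * harm m \<le> x * (1 + ln x)"
  proof -
    have "ln (real m) \<le> ln x" using m True by simp
    then have "harm m \<le> 1 + ln x" using harm_le_one_plus_ln[OF m(1)] by linarith
    then show ?thesis using True by (intro mult_left_mono) auto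
  qed
  moreover have "x * (1 + ln x) = x + x * ln x" by (simp add: distrib_left)
  moreover have "max 1 x = x" using True by simp
  ultimately show ?thesis using m card xh by linarith
qed

section \<open>The sum over the region under the curve u^2 e = N\<close>

text \<open>The range of \<open>(u, e)\<close> in the case \<open>u < v\<close>, where
  \<open>u^2 e \<le> N\<close>. The factor \<open>q\<close> appears once multiples are taken: it is
  \<open>\<alpha>^2 \<delta>\<close> for \<open>u\<close>, \<open>e\<close> multiples of
  \<open>\<alpha>\<close>, \<open>\<delta>\<close>.\<close>

definition region :: "nat \<Rightarrow> nat \<Rightarrow> (nat \<times> nat) set" where
  "region q N = {(u, e). 0 < u \<and> 0 < e \<and> q * u\<^sup>2 * e \<le> N}"

lemma region_subset:
  assumes "q \<ge> 1"
  shows "region q N \<subseteq> {1..N} \<times> {1..N}"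
proof
  fix z assume "z \<in> region q N"
  then obtain u e where z: "z = (u, e)" "0 < u" "0 < e" "q * u\<^sup>2 * e \<le> N"
    by (auto simp: region_def)
  have "u * 1 \<le> u * (q * u * e)" using z assms by (intro mult_le_mono2) (simp add: Suc_leI)
  moreover have "1 * e \<le> (q * u\<^sup>2) * e" using z assms by (intro mult_le_mono1) (simp add: Suc_leI)
  moreover have "u * (q * u * e) = q * u\<^sup>2 * e" by (simp add: power2_eq_square mult_ac)
  ultimately have "u \<le> N" "e \<le> N" using z(4) by linarith+
  then show "z \<in> {1..N} \<times> {1..N}"
    using z by simp
qed

lemma finite_region: "q \<ge> 1 \<Longrightarrow> finite (region q N)"
  using region_subset by (rule finite_subset) auto

lemma region_antimono: "q \<le> q' \<Longrightarrow> region q' N \<subseteq> region q N"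
  by (auto simp: region_def intro: order.trans[OF mult_le_mono1])

lemma ex_floor_sqrt:
  fixes N :: nat
  obtains M where "M\<^sup>2 \<le> N" "N < (M + 1)\<^sup>2"
proof -
  define M where "M = nat \<lfloor>sqrt (real N)\<rfloor>"
  have "real M \<le> sqrt (real N)" "sqrt (real N) < real M + 1"
    by (simp_all add: M_def)
  then have "(real M)\<^sup>2 \<le> (sqrt (real N))\<^sup>2" "(sqrt (real N))\<^sup>2 < (real M + 1)\<^sup>2"
    by (intro power_mono power_strict_mono; simp)+
  then have "real (M\<^sup>2) \<le> real N" "real N < real ((M + 1)\<^sup>2)" by (simp_all add: add.commute)
  then show ?thesis using that[of M] by linarith
qed

text \<open>Heuristically, put \<open>u = N^s\<close>, \<open>e = N^t\<close>: the sum becomes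
  \<open>L^3\<close> times the integral of \<open>1 - s - t\<close> over
  \<open>s, t \<ge> 0\<close>, \<open>2 s + t \<le> 1\<close>, which is \<open>1 / 8\<close>. The
  proof sums over \<open>e\<close>, then over \<open>u\<close>, with the harmonic and logarithmic
  sums above; both stages have errors of order \<open>(1 + L)^2\<close>.\<close>

lemma abs_region_sum_minus_le:
  assumes "N \<ge> 1"
  defines "L \<equiv> ln (real N)"
  shows "\<bar>(\<Sum>(u, e)\<in>region 1 N. ln (real N / real (u * e)) / real (u * e)) - L ^ 3 / 8\<bar> \<le> 6 * (1 + L)\<^sup>2"
proof -
  obtain M where M: "M\<^sup>2 \<le> N" "N < (M + 1)\<^sup>2" by (rule ex_floor_sqrt)
  have M1: "M \<ge> 1" using M assms by (cases M) auto
  have L: "0 \<le> L" using assms by simp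
  have reg: "region 1 N = (SIGMA u:{1..M}. {1..N div u\<^sup>2})"
  proof -
    have "u \<le> M" if "0 < u" "0 < e" "u\<^sup>2 * e \<le> N" for u e :: nat
    proof (rule ccontr)
      assume "\<not> u \<le> M"
      then have "(M + 1)\<^sup>2 \<le> u\<^sup>2" by (intro power_mono) auto
      moreover have "u\<^sup>2 * 1 \<le> u\<^sup>2 * e" using that by (intro mult_le_mono2) auto
      ultimately show False using M that by linarith
    qed
    moreover have "e \<le> N div u\<^sup>2 \<longleftrightarrow> u\<^sup>2 * e \<le> N" if "0 < u" for u e :: nat
      using that by (simp add: less_eq_div_iff_mult_less_eq mult.commute)
    ultimately show ?thesis by (auto simp: region_def)
  qed
  \<comment> \<open>With \<open>l = ln u\<close>, the range of \<open>e\<close> ends near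
    \<open>N / u^2\<close>, whose logarithm is \<open>L - 2 l\<close>. Apart from the factor
    \<open>1 / u\<close>, the expected value is
    \<open>(L - l) (L - 2 l) - (L - 2 l)^2 / 2 = (L - 2 l) L / 2\<close>.\<close>
  have inner: "\<bar>(\<Sum>e=1..N div u\<^sup>2. ln (real N / real (u * e)) / real (u * e)) - (L - 2 * ln (real u)) * L / 2 / real u\<bar>
      \<le> 4 * (1 + L) * (1 / real u)" if u: "u \<in> {1..M}" for u
  proof -
    define y where "y = N div u\<^sup>2"
    define l where "l = ln (real u)"
    have "u\<^sup>2 \<le> M\<^sup>2" using u by (intro power_mono) auto
    then have "u\<^sup>2 \<le> N" using M by linarith
    then have y1: "y \<ge> 1" using u by (simp add: y_def Suc_le_eq div_greater_zero_iff)
    \<comment> \<open>As \<open>y \<ge> 1\<close>, rounding \<open>N / u^2\<close> down loses at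
      most a factor 2, hence at most \<open>ln 2 \<le> 1\<close> in the logarithm.\<close>
    have y: "real y \<le> real N / (real u)\<^sup>2" "real N / (real u)\<^sup>2 \<le> 2 * real y"
    proof -
      have "y * u\<^sup>2 \<le> N" "N < (y + 1) * u\<^sup>2"
        using u by (simp_all add: y_def dividend_less_div_times)
      then have "real (y * u\<^sup>2) \<le> real N" "real N < real ((y + 1) * u\<^sup>2)"
        by (simp_all only: of_nat_le_iff of_nat_less_iff)
      moreover have "real ((y + 1) * u\<^sup>2) \<le> (2 * real y) * (real u)\<^sup>2"
        using y1 mult_right_mono[of 1 "real y" "(real u)\<^sup>2"] by (simp add: algebra_simps)
      moreover have "0 < (real u)\<^sup>2" using u by simp
      ultimately show "real y \<le> real N / (real u)\<^sup>2" "real N / (real u)\<^sup>2 \<le> 2 * real y"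
        by (simp_all only: pos_le_divide_eq pos_divide_le_eq of_nat_mult of_nat_power)
    qed
    have lnNu: "ln (real N / (real u)\<^sup>2) = L - 2 * l"
      using u assms by (simp add: ln_div ln_realpow L_def l_def)
    have "ln (real y) \<le> L - 2 * l"
      using y1 y unfolding lnNu[symmetric] by (intro ln_mono) auto
    moreover have "L - 2 * l \<le> ln (2 * real y)"
      using y1 y assms u unfolding lnNu[symmetric] by (intro ln_mono) auto
    then have "L - 2 * l \<le> ln (real y) + 1"
      using y1 ln_le_minus_one[of 2] by (simp add: ln_mult)
    ultimately have lny: "ln (real y) \<le> L - 2 * l" "L - 2 * l \<le> ln (real y) + 1" by auto
    have l: "0 \<le> l" "0 \<le> ln (real y)" using u y1 by (simp_all add: l_def)
    have "(\<Sum>e=1..y. ln (real N / real (u * e)) / real (u * e))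
        = (\<Sum>e=1..y. (L - l) / real u * inverse (real e) - ln (real e) / real e / real u)"
      using u assms by (intro sum.cong) (auto simp: ln_div ln_mult L_def l_def field_simps)
    also have "\<dots> = ((L - l) * harm y - (\<Sum>e=1..y. ln (real e) / real e)) / real u"
      unfolding sum_subtractf harm_def sum_distrib_left[symmetric] sum_divide_distrib[symmetric]
      by (simp flip: diff_divide_distrib)
    finally have eq: "(\<Sum>e=1..y. ln (real N / real (u * e)) / real (u * e)) - (L - 2 * l) * L / 2 / real u
       = ((L - l) * harm y - (\<Sum>e=1..y. ln (real e) / real e) - (L - 2 * l) * L / 2) / real u"
      by (simp add: diff_divide_distrib)
    have h: "\<bar>harm y - (L - 2 * l)\<bar> \<le> 2"
      using abs_harm_minus_ln_le[OF y1] lny by linarith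
    have h': "\<bar>(L - l) * (harm y - (L - 2 * l))\<bar> \<le> L * 2"
      unfolding abs_mult using h l lny by (intro mult_mono) auto
    have s: "\<bar>(\<Sum>e=1..y. ln (real e) / real e) - (ln (real y))\<^sup>2 / 2\<bar> \<le> 1 + L"
      using abs_sum_ln_div_le[OF y1] lny l by linarith
    have q: "\<bar>(L - 2 * l)\<^sup>2 - (ln (real y))\<^sup>2\<bar> \<le> 1 * (2 * L)"
    proof -
      have "(L - 2 * l)\<^sup>2 - (ln (real y))\<^sup>2 = ((L - 2 * l) - ln (real y)) * ((L - 2 * l) + ln (real y))"
        by (simp add: power2_eq_square algebra_simps)
      then show ?thesis
        using lny l by (simp only: abs_mult) (intro mult_mono, auto)
    qed
    \<comment> \<open>This identity isolates three errors: that of the harmonic number, that of the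
      sum of \<open>ln e / e\<close>, and that of \<open>ln y\<close> against \<open>L - 2 l\<close>
      in the square.\<close>
    have "(L - l) * harm y - (\<Sum>e=1..y. ln (real e) / real e) - (L - 2 * l) * L / 2
       = (L - l) * (harm y - (L - 2 * l)) - ((\<Sum>e=1..y. ln (real e) / real e) - (ln (real y))\<^sup>2 / 2)
         + ((L - 2 * l)\<^sup>2 - (ln (real y))\<^sup>2) / 2"
      by (simp add: power2_eq_square field_simps)
    moreover have "\<bar>a - b + c / 2\<bar> \<le> 4 * (1 + L)"
      if "\<bar>a\<bar> \<le> L * 2" "\<bar>b\<bar> \<le> 1 + L" "\<bar>c\<bar> \<le> 1 * (2 * L)" for a b c :: real
      using that L by (simp add: abs_le_iff)
    ultimately have "\<bar>(L - l) * harm y - (\<Sum>e=1..y. ln (real e) / real e) - (L - 2 * l) * L / 2\<bar> \<le> 4 * (1 + L)"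
      using h' s q by presburger
    then have "\<bar>(\<Sum>e=1..y. ln (real N / real (u * e)) / real (u * e)) - (L - 2 * l) * L / 2 / real u\<bar> \<le> 4 * (1 + L) / real u"
      unfolding eq by (simp add: divide_right_mono)
    then show ?thesis by (simp add: y_def l_def)
  qed
  define T where "T = (\<Sum>(u, e)\<in>region 1 N. ln (real N / real (u * e)) / real (u * e))"
  have lnM: "ln (real M) \<le> L / 2" "L / 2 \<le> ln (real M) + 1"
  proof -
    have "real (M\<^sup>2) \<le> real N" using M by (simp only: of_nat_le_iff)
    then have "ln ((real M)\<^sup>2) \<le> L" unfolding L_def using M1 by (intro ln_mono) auto
    then show "ln (real M) \<le> L / 2" using M1 by (simp add: ln_realpow)
    have "N \<le> (2 * M)\<^sup>2" using M M1 power_mono[of "M + 1" "2 * M" 2] by linarith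
    then have "real N \<le> real ((2 * M)\<^sup>2)" by (simp only: of_nat_le_iff)
    then have "real N \<le> (2 * real M)\<^sup>2" by simp
    then have "L \<le> ln ((2 * real M)\<^sup>2)" unfolding L_def using M1 assms by (intro ln_mono) auto
    also have "ln ((2 * real M)\<^sup>2) = 2 * ln (2 * real M)" using M1 by (subst ln_realpow) auto
    also have "ln (2 * real M) = ln 2 + ln (real M)" using M1 by (simp add: ln_mult)
    finally have "L \<le> 2 * (ln 2 + ln (real M))" .
    then show "L / 2 \<le> ln (real M) + 1" using ln_le_minus_one[of 2] by simp
  qed
  have M0: "0 \<le> ln (real M)" using M1 by simp
  have "\<bar>T - (\<Sum>u=1..M. (L - 2 * ln (real u)) * L / 2 / real u)\<bar> \<le> (\<Sum>u=1..M. 4 * (1 + L) * (1 / real u))"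
    unfolding T_def reg sum.Sigma[symmetric] sum_subtractf[symmetric]
    by (subst sum.Sigma[symmetric], simp, simp, subst sum_subtractf[symmetric]) (intro order.trans[OF sum_abs] sum_mono inner, auto)
  also have "\<dots> = 4 * (1 + L) * harm M"
    by (simp add: harm_def sum_distrib_left divide_inverse)
  also have "\<dots> \<le> 4 * (1 + L) * (1 + L)"
    using harm_le_one_plus_ln[OF M1] lnM L by (intro mult_left_mono) auto
  also have "\<dots> = 4 * (1 + L)\<^sup>2" by (simp add: power2_eq_square algebra_simps)
  finally have T: "\<bar>T - (\<Sum>u=1..M. (L - 2 * ln (real u)) * L / 2 / real u)\<bar> \<le> 4 * (1 + L)\<^sup>2" .
  have "(\<Sum>u=1..M. (L - 2 * ln (real u)) * L / 2 / real u)
      = (\<Sum>u=1..M. L\<^sup>2 / 2 * inverse (real u) - L * (ln (real u) / real u))"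
    by (intro sum.cong) (auto simp: field_simps power2_eq_square)
  also have "\<dots> = L\<^sup>2 / 2 * harm M - L * (\<Sum>u=1..M. ln (real u) / real u)"
    by (simp add: sum_subtractf harm_def sum_distrib_left)
  finally have main: "(\<Sum>u=1..M. (L - 2 * ln (real u)) * L / 2 / real u) = \<dots>" .
  have "\<bar>harm M - L / 2\<bar> \<le> 2" using abs_harm_minus_ln_le[OF M1] lnM by linarith
  then have 1: "\<bar>L\<^sup>2 / 2 * (harm M - L / 2)\<bar> \<le> L\<^sup>2 / 2 * 2"
    unfolding abs_mult by (intro mult_mono) auto
  have "\<bar>(L / 2)\<^sup>2 - (ln (real M))\<^sup>2\<bar> \<le> 1 * L"
  proof -
    have "(L / 2)\<^sup>2 - (ln (real M))\<^sup>2 = (L / 2 - ln (real M)) * (L / 2 + ln (real M))"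
      by (simp add: power2_eq_square algebra_simps)
    then show ?thesis using lnM M0 by (simp only: abs_mult) (intro mult_mono, auto)
  qed
  then have "\<bar>(\<Sum>u=1..M. ln (real u) / real u) - L\<^sup>2 / 8\<bar> \<le> 1 + L"
    using abs_sum_ln_div_le[OF M1] lnM by (simp add: power_divide abs_le_iff)
  then have 2: "\<bar>L * ((\<Sum>u=1..M. ln (real u) / real u) - L\<^sup>2 / 8)\<bar> \<le> L * (1 + L)"
    unfolding abs_mult using L by (intro mult_mono) auto
  \<comment> \<open>As \<open>ln M\<close> is within 1 of \<open>L / 2\<close>, the outer main term
    is \<open>L^2 / 2 * (L / 2) - L * (L^2 / 8) = L^3 / 8\<close>.\<close>
  have "L\<^sup>2 / 2 * harm M - L * (\<Sum>u=1..M. ln (real u) / real u) - L ^ 3 / 8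
     = L\<^sup>2 / 2 * (harm M - L / 2) - L * ((\<Sum>u=1..M. ln (real u) / real u) - L\<^sup>2 / 8)"
    by (simp add: power2_eq_square power3_eq_cube field_simps)
  moreover have "\<bar>a - b\<bar> \<le> L\<^sup>2 + L * (1 + L)"
    if "\<bar>a\<bar> \<le> L\<^sup>2 / 2 * 2" "\<bar>b\<bar> \<le> L * (1 + L)" for a b :: real
    using that by linarith
  ultimately have "\<bar>L\<^sup>2 / 2 * harm M - L * (\<Sum>u=1..M. ln (real u) / real u) - L ^ 3 / 8\<bar> \<le> L\<^sup>2 + L * (1 + L)"
    using 1 2 by presburger
  also have "\<dots> \<le> 2 * (1 + L)\<^sup>2" using L by (simp add: power2_eq_square algebra_simps)
  finally have "\<bar>T - L ^ 3 / 8\<bar> \<le> 6 * (1 + L)\<^sup>2"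
    using T main by linarith
  then show ?thesis by (simp add: T_def)
qed


section \<open>Counting quadruples with divisibility conditions\<close>

text \<open>\<open>A\<close> and \<open>E\<close> are the actual values of \<open>u\<close> and
  \<open>e\<close>, and \<open>k\<close> collects the moduli pulled out of \<open>a\<close> and
  \<open>b\<close>. Thus \<open>k * (a * b) - A\<close> is \<open>v\<close>, and
  \<open>2 * A < k * (a * b)\<close> says \<open>u < v\<close>.\<close>

definition fibre :: "nat \<Rightarrow> nat \<Rightarrow> nat \<Rightarrow> nat \<Rightarrow> (nat \<times> nat) set" where
  "fibre A k E N = {(a, b). 0 < a \<and> 0 < b \<and> 2 * A < k * (a * b) \<and> A * (k * (a * b) - A) * E \<le> N}"

lemma fibre_eq:
  assumes "A \<ge> 1" "k \<ge> 1" "E \<ge> 1"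
  shows "fibre A k E N = hyperbola_points ((A + real N / (A * E)) / k) - hyperbola_points (2 * A / k)"
proof -
  have "2 * A < k * (a * b) \<and> A * (k * (a * b) - A) * E \<le> N \<longleftrightarrow>
        real (a * b) \<le> (A + real N / (A * E)) / k \<and> \<not> real (a * b) \<le> 2 * A / k" for a b
  proof -
    have "real (a * b) \<le> 2 * A / k \<longleftrightarrow> real (k * (a * b)) \<le> real (2 * A)"
      using assms by (simp add: field_simps)
    also have "\<dots> \<longleftrightarrow> \<not> 2 * A < k * (a * b)"
      unfolding of_nat_le_iff by auto
    finally have 1: "\<not> real (a * b) \<le> 2 * A / k \<longleftrightarrow> 2 * A < k * (a * b)" by simp
    \<comment> \<open>The lower bound on \<open>k * (a * b)\<close> keeps the natural-number
      subtraction from truncating, so the condition can be moved to the reals.\<close>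
    have "A * (k * (a * b) - A) * E \<le> N \<longleftrightarrow> real (a * b) \<le> (A + real N / (A * E)) / k"
      if "2 * A < k * (a * b)"
    proof -
      have "A * (k * (a * b) - A) * E \<le> N \<longleftrightarrow> real (A * (k * (a * b) - A) * E) \<le> real N"
        by (simp only: of_nat_le_iff)
      also have "real (A * (k * (a * b) - A) * E) = (real k * real (a * b) - real A) * (real A * real E)"
        using that by (simp add: of_nat_diff)
      also have "\<dots> \<le> real N \<longleftrightarrow> real k * real (a * b) - real A \<le> real N / (A * E)"
        using assms by (subst pos_le_divide_eq) auto
      also have "\<dots> \<longleftrightarrow> real (a * b) * real k \<le> A + real N / (A * E)"
        by (simp only: mult.commute[of "real k"] diff_le_eq add.commute)
      also have "\<dots> \<longleftrightarrow> real (a * b) \<le> (A + real N / (A * E)) / k"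
        using assms by (subst pos_le_divide_eq) auto
      finally show ?thesis .
    qed
    then show ?thesis using 1 by blast
  qed
  then show ?thesis by (auto simp: fibre_def hyperbola_points_def)
qed

text \<open>\<open>A * A * E \<le> N\<close> means \<open>A \<le> V\<close>, so passing from the
  outer bound \<open>(A + V) / k\<close> to \<open>V / k\<close> changes the argument of the
  logarithm by at most a factor 2. The terms in \<open>A / k\<close> that carry a logarithm are kept
  apart: bounding \<open>A\<close> by \<open>V\<close> there would give an error of the order of the
  main term after summation.\<close>

lemma abs_card_fibre_minus_le:
  assumes "A \<ge> 1" "k \<ge> 1" "E \<ge> 1" "A * A * E \<le> N"
  defines "V \<equiv> real N / (A * E)"
  shows "\<bar>real (card (fibre A k E N)) - V / k * ln (max 1 (V / k))\<bar>
    \<le> 5 * (V / k) + 2 * (real A / k * (1 + ln (real N)))"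
proof -
  define X where "X = (A + V) / k"
  define Y where "Y = 2 * real A / k"
  have N: "N \<ge> 1" using assms by (cases N) auto
  have "real (A * A * E) \<le> real N" using assms by (simp only: of_nat_le_iff)
  then have "real A * (real A * real E) \<le> real N" by simp
  then have AV: "real A \<le> V"
    unfolding V_def using assms by (subst pos_le_divide_eq) auto
  have "1 * 1 \<le> real A * real E" using assms by (intro mult_mono) auto
  then have VN: "V \<le> real N"
    unfolding V_def using frac_le[of "real N" "real N" 1 "real A * real E"] by simp
  have X: "0 < X" "V / k \<le> X" "X \<le> 2 * (V / k)" "Y \<le> X"
    and Y: "0 < Y" and V: "0 < V / k"
    using assms(1,2) AV by (simp_all add: X_def Y_def divide_right_mono add_pos_pos field_simps)
  have "real (card (fibre A k E N)) = real (card (hyperbola_points X)) - real (card (hyperbola_points Y))"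
  proof -
    have "hyperbola_points Y \<subseteq> hyperbola_points X"
      using X by (auto simp: hyperbola_points_def)
    then show ?thesis
      using fibre_eq[OF assms(1-3), of N]
      by (simp add: X_def Y_def V_def card_Diff_subset finite_hyperbola_points card_mono of_nat_diff)
  qed
  moreover have "X + Y \<le> 4 * (V / k)"
    using AV X divide_right_mono[of "real A" V "real k"] by (simp add: X_def Y_def add_divide_distrib)
  moreover note abs_card_hyperbola_points_le[OF X(1)] abs_card_hyperbola_points_le[OF Y]
  ultimately have 1: "\<bar>real (card (fibre A k E N)) - (X * ln (max 1 X) - Y * ln (max 1 Y))\<bar> \<le> 4 * (V / k)"
    by linarith
  have Vk: "V / k \<le> real N"
  proof -
    have "0 \<le> V" using AV by linarith
    then have "V / k \<le> V / 1" using assms(2) by (intro divide_left_mono) auto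
    then show ?thesis using VN by simp
  qed
  have lnX: "0 \<le> ln (max 1 X)" "ln (max 1 X) \<le> 1 + ln (real N)"
  proof -
    have "1 \<le> real N" using N by simp
    then have "max 1 X \<le> 2 * real N" using X Vk by linarith
    then have "ln (max 1 X) \<le> ln (2 * real N)" by (intro ln_mono) auto
    then show "ln (max 1 X) \<le> 1 + ln (real N)"
      using N ln_le_minus_one[of 2] by (simp add: ln_mult)
  qed auto
  have lnY: "0 \<le> ln (max 1 Y)" "ln (max 1 Y) \<le> 1 + ln (real N)"
  proof -
    have "ln (max 1 Y) \<le> ln (max 1 X)" using X by (intro ln_mono) auto
    then show "ln (max 1 Y) \<le> 1 + ln (real N)" using lnX by linarith
  qed auto
  have lnV: "ln (max 1 (V / k)) \<le> ln (max 1 X)" "ln (max 1 X) \<le> ln (max 1 (V / k)) + 1"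
  proof -
    show "ln (max 1 (V / k)) \<le> ln (max 1 X)" using X by (intro ln_mono) auto
    have "ln (max 1 X) \<le> ln (2 * max 1 (V / k))" using X by (intro ln_mono) auto
    also have "\<dots> = ln 2 + ln (max 1 (V / k))" by (intro ln_mult_pos) auto
    finally show "ln (max 1 X) \<le> ln (max 1 (V / k)) + 1"
      using ln_le_minus_one[of 2] by simp
  qed
  have "X * ln (max 1 X) = V / k * ln (max 1 X) + real A / k * ln (max 1 X)"
    by (simp add: X_def add_divide_distrib algebra_simps)
  moreover have "V / k * ln (max 1 (V / k)) \<le> V / k * ln (max 1 X)"
    using lnV V by (intro mult_left_mono) auto
  moreover have "V / k * ln (max 1 X) \<le> V / k * (ln (max 1 (V / k)) + 1)"
    using lnV V by (intro mult_left_mono) auto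
  then have "V / k * ln (max 1 X) \<le> V / k * ln (max 1 (V / k)) + V / k"
    by (simp add: distrib_left)
  moreover have "0 \<le> real A / k * ln (max 1 X)" using lnX by simp
  moreover have "real A / k * ln (max 1 X) \<le> real A / k * (1 + ln (real N))"
    using lnX by (intro mult_left_mono) auto
  moreover have "0 \<le> Y * ln (max 1 Y)" using lnY Y by simp
  moreover have "Y * ln (max 1 Y) \<le> Y * (1 + ln (real N))"
    using lnY Y by (intro mult_left_mono) auto
  moreover have "Y * (1 + ln (real N)) = 2 * (real A / k * (1 + ln (real N)))"
    by (simp add: Y_def)
  moreover have "0 \<le> real A / k * (1 + ln (real N))" using N by simp
  ultimately show ?thesis using 1 by linarith
qed

text \<open>In terms of the original variables, \<open>a * b = u + v\<close>; no truncation occurs in \<open>a * b - u = v\<close>.\<close>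

definition quads :: "nat \<Rightarrow> nat \<Rightarrow> nat \<Rightarrow> nat \<Rightarrow> nat \<Rightarrow> ((nat \<times> nat) \<times> (nat \<times> nat)) set" where
  "quads \<alpha> \<beta> \<gamma> \<delta> N = {((u, e), (a, b)). 0 < u \<and> 0 < e \<and> 0 < a \<and> 0 < b \<and>
     2 * u < a * b \<and> u * (a * b - u) * e \<le> N \<and> \<alpha> dvd u \<and> \<beta> dvd a \<and> \<gamma> dvd b \<and> \<delta> dvd e}"

lemma finite_fibre: "A \<ge> 1 \<Longrightarrow> k \<ge> 1 \<Longrightarrow> E \<ge> 1 \<Longrightarrow> finite (fibre A k E N)"
  by (simp add: fibre_eq finite_hyperbola_points)

text \<open>Each variable is divided by its modulus. Restricting \<open>(u, e)\<close> to the region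
  loses nothing, since \<open>u < v\<close> forces \<open>u^2 e \<le> N\<close> for the undivided
  variables.\<close>

lemma card_quads:
  assumes "\<alpha> \<ge> 1" "\<beta> \<ge> 1" "\<gamma> \<ge> 1" "\<delta> \<ge> 1"
  shows "card (quads \<alpha> \<beta> \<gamma> \<delta> N) = (\<Sum>(u, e)\<in>region (\<alpha>\<^sup>2 * \<delta>) N. card (fibre (\<alpha> * u) (\<beta> * \<gamma>) (\<delta> * e) N))"
proof -
  define f :: "(nat \<times> nat) \<times> (nat \<times> nat) \<Rightarrow> (nat \<times> nat) \<times> (nat \<times> nat)"
    where "f = (\<lambda>((u, e), (a, b)). ((\<alpha> * u, \<delta> * e), (\<beta> * a, \<gamma> * b)))"
  define fib where "fib = (\<lambda>(u, e). fibre (\<alpha> * u) (\<beta> * \<gamma>) (\<delta> * e) N)"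
  have "quads \<alpha> \<beta> \<gamma> \<delta> N = f ` Sigma (region (\<alpha>\<^sup>2 * \<delta>) N) fib"
  proof (intro equalityI subsetI)
    fix z assume "z \<in> quads \<alpha> \<beta> \<gamma> \<delta> N"
    then obtain u e a b where z: "z = ((\<alpha> * u, \<delta> * e), (\<beta> * a, \<gamma> * b))"
      and pos: "0 < u" "0 < e" "0 < a" "0 < b"
      and lt: "2 * (\<alpha> * u) < (\<beta> * a) * (\<gamma> * b)"
      and le: "(\<alpha> * u) * ((\<beta> * a) * (\<gamma> * b) - \<alpha> * u) * (\<delta> * e) \<le> N"
      by (auto simp: quads_def elim!: dvdE)
    have ab: "(\<beta> * a) * (\<gamma> * b) = \<beta> * \<gamma> * (a * b)" by (simp add: mult_ac)
    have "(\<alpha>\<^sup>2 * \<delta>) * u\<^sup>2 * e = (\<alpha> * u) * (\<alpha> * u) * (\<delta> * e)"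
      by (simp add: power2_eq_square mult_ac)
    also have "\<dots> \<le> (\<alpha> * u) * ((\<beta> * a) * (\<gamma> * b) - \<alpha> * u) * (\<delta> * e)"
      using lt by (intro mult_le_mono1 mult_le_mono2) linarith
    also note le
    finally have "(u, e) \<in> region (\<alpha>\<^sup>2 * \<delta>) N" using pos by (simp add: region_def)
    moreover have "(a, b) \<in> fib (u, e)"
      using pos lt le unfolding ab fib_def fibre_def by simp
    ultimately have "((u, e), (a, b)) \<in> Sigma (region (\<alpha>\<^sup>2 * \<delta>) N) fib" by blast
    moreover have "z = f ((u, e), (a, b))" by (simp add: z f_def)
    ultimately show "z \<in> f ` Sigma (region (\<alpha>\<^sup>2 * \<delta>) N) fib" by blast
  next
    fix z assume "z \<in> f ` Sigma (region (\<alpha>\<^sup>2 * \<delta>) N) fib"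
    then show "z \<in> quads \<alpha> \<beta> \<gamma> \<delta> N"
      using assms by (auto simp: f_def fib_def fibre_def region_def quads_def mult_ac)
  qed
  moreover have "inj_on f (Sigma (region (\<alpha>\<^sup>2 * \<delta>) N) fib)"
    using assms by (auto simp: inj_on_def f_def)
  ultimately have "card (quads \<alpha> \<beta> \<gamma> \<delta> N) = card (Sigma (region (\<alpha>\<^sup>2 * \<delta>) N) fib)"
    by (simp add: card_image)
  also have "\<dots> = (\<Sum>z\<in>region (\<alpha>\<^sup>2 * \<delta>) N. card (fib z))"
    using assms by (intro card_SigmaI finite_region ballI) (auto simp: fib_def region_def intro!: finite_fibre)
  finally show ?thesis by (simp add: fib_def case_prod_unfold)
qed

section \<open>Sums over the region that bound the error terms\<close>

lemma mem_region_iff: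
  assumes "q \<ge> 1"
  shows "(u, e) \<in> region q N \<longleftrightarrow> u \<in> {1..N} \<and> e \<in> {1..N} \<and> q * u\<^sup>2 * e \<le> N"
proof
  assume h: "(u, e) \<in> region q N"
  then have "(u, e) \<in> {1..N} \<times> {1..N}" using region_subset[OF assms] by blast
  then show "u \<in> {1..N} \<and> e \<in> {1..N} \<and> q * u\<^sup>2 * e \<le> N"
    using h by (simp add: region_def)
qed (simp add: region_def)

lemma sum_region_inverse_le:
  assumes "q \<ge> 1" "N \<ge> 1"
  shows "(\<Sum>(u, e)\<in>region q N. 1 / (real u * real e)) \<le> (1 + ln (real N))\<^sup>2"
proof -
  have "(\<Sum>(u, e)\<in>region q N. 1 / (real u * real e)) \<le> (\<Sum>(u, e)\<in>{1..N} \<times> {1..N}. 1 / (real u * real e))"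
    using region_subset[OF assms(1)] by (intro sum_mono2) auto
  also have "\<dots> = harm N * harm N"
    unfolding harm_def sum_product sum.cartesian_product by (simp add: divide_inverse)
  also have "\<dots> \<le> (1 + ln (real N)) * (1 + ln (real N))"
    using harm_le_one_plus_ln[OF assms(2)] assms(2) by (intro mult_mono harm_nonneg) auto
  finally show ?thesis by (simp add: power2_eq_square)
qed

text \<open>This handles the \<open>A / k\<close> terms of the fibres. For fixed \<open>e\<close>,
  \<open>u\<close> runs up to the root \<open>m\<close> of \<open>N / (q e)\<close>, and
  \<open>m\<close> terms of size at most \<open>m\<close> contribute at most
  \<open>N / (q e)\<close>; only the sum over \<open>e\<close> produces a logarithm.\<close>

lemma sum_region_fst_le:
  assumes "q \<ge> 1" "N \<ge> 1"
  shows "(\<Sum>(u, e)\<in>region q N. real u) \<le> real N / real q * (1 + ln (real N))"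
proof -
  have inner: "(\<Sum>u\<in>{u\<in>{1..N}. q * u\<^sup>2 * e \<le> N}. real u) \<le> real N / real q * inverse (real e)"
    if e: "e \<in> {1..N}" for e
  proof -
    obtain m where m: "m\<^sup>2 \<le> N div (q * e)" "N div (q * e) < (m + 1)\<^sup>2" by (rule ex_floor_sqrt)
    have qe: "0 < q * e" using e assms by simp
    have "u \<le> m" if "q * u\<^sup>2 * e \<le> N" for u
    proof (rule ccontr)
      assume "\<not> u \<le> m"
      then have "(m + 1)\<^sup>2 \<le> u\<^sup>2" by (intro power_mono) auto
      moreover have "u\<^sup>2 \<le> N div (q * e)"
        using that qe by (simp add: less_eq_div_iff_mult_less_eq mult_ac)
      ultimately show False using m by linarith
    qed
    then have "(\<Sum>u\<in>{u\<in>{1..N}. q * u\<^sup>2 * e \<le> N}. real u) \<le> (\<Sum>u=1..m. real u)"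
      by (intro sum_mono2) auto
    also have "\<dots> \<le> (\<Sum>u=1..m. real m)" by (intro sum_mono) auto
    also have "\<dots> = real (m\<^sup>2)" by (simp add: power2_eq_square)
    also have "\<dots> \<le> real N / real (q * e)"
    proof -
      have "m\<^sup>2 * (q * e) \<le> N" using m(1) qe by (simp add: less_eq_div_iff_mult_less_eq)
      then have "real (m\<^sup>2 * (q * e)) \<le> real N" by (simp only: of_nat_le_iff)
      then show ?thesis using qe by (subst pos_le_divide_eq) (auto simp: mult_ac)
    qed
    finally show ?thesis using assms by (simp add: divide_inverse mult_ac)
  qed
  have "(\<Sum>(u, e)\<in>region q N. real u)
      = (\<Sum>(e, u)\<in>(SIGMA e:{1..N}. {u\<in>{1..N}. q * u\<^sup>2 * e \<le> N}). real u)"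
    by (rule sum.reindex_bij_witness[of _ prod.swap prod.swap])
      (auto simp: mem_region_iff[OF assms(1)])
  also have "\<dots> = (\<Sum>e=1..N. \<Sum>u\<in>{u\<in>{1..N}. q * u\<^sup>2 * e \<le> N}. real u)"
    by (subst sum.Sigma) auto
  also have "\<dots> \<le> (\<Sum>e=1..N. real N / real q * inverse (real e))"
    using inner by (rule sum_mono)
  also have "\<dots> = real N / real q * harm N" by (simp add: harm_def sum_distrib_left)
  also have "\<dots> \<le> real N / real q * (1 + ln (real N))"
    using harm_le_one_plus_ln[OF assms(2)] by (intro mult_left_mono) auto
  finally show ?thesis .
qed

text \<open>The price of replacing \<open>region q N\<close> by the fixed \<open>region 1 N\<close>.
  For fixed \<open>u\<close> the excess values of \<open>e\<close> lie between
  \<open>N / (q u^2)\<close> and \<open>N / u^2\<close>, and the harmonic sum over such a range is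
  about \<open>ln q\<close>.\<close>

lemma sum_region_diff_inverse_le:
  assumes "q \<ge> 1" "N \<ge> 1"
  shows "(\<Sum>(u, e)\<in>region 1 N - region q N. 1 / (real u * real e)) \<le> (1 + ln (real N)) * (1 + ln (real q))"
proof -
  have inner: "(\<Sum>e\<in>{e\<in>{1..N}. u\<^sup>2 * e \<le> N \<and> \<not> q * u\<^sup>2 * e \<le> N}. 1 / (real u * real e))
      \<le> inverse (real u) * (1 + ln (real q))" if u: "u \<in> {1..N}" for u
  proof -
    define y where "y = N div u\<^sup>2"
    define y' where "y' = N div (q * u\<^sup>2)"
    have pos: "0 < u\<^sup>2" "0 < q * u\<^sup>2" using u assms by auto
    have yy: "y' \<le> y" using pos assms by (auto simp: y_def y'_def intro!: div_le_mono2)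
    have "{e\<in>{1..N}. u\<^sup>2 * e \<le> N \<and> \<not> q * u\<^sup>2 * e \<le> N} \<subseteq> {1..y} - {1..y'}"
      using pos by (auto simp: y_def y'_def less_eq_div_iff_mult_less_eq mult_ac)
    then have "(\<Sum>e\<in>{e\<in>{1..N}. u\<^sup>2 * e \<le> N \<and> \<not> q * u\<^sup>2 * e \<le> N}. inverse (real e))
        \<le> (\<Sum>e\<in>{1..y} - {1..y'}. inverse (real e))"
      by (intro sum_mono2) auto
    also have "\<dots> = harm y - harm y'"
      unfolding harm_def using yy by (intro sum_diff) auto
    also have "\<dots> \<le> 1 + ln (real q)"
    proof (cases "y \<ge> 1")
      case True
      have "y * u\<^sup>2 \<le> N" by (simp add: y_def)
      then have "real (y * u\<^sup>2) \<le> real N" by (simp only: of_nat_le_iff)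
      then have "real y \<le> real N / (real u)\<^sup>2"
        using u by (simp add: pos_le_divide_eq)
      then have "ln (real y) \<le> ln (real N / (real u)\<^sup>2)" using True by (intro ln_mono) auto
      moreover have "ln (real N / (real q * (real u)\<^sup>2)) \<le> ln (real y' + 1)"
      proof -
        have "N < (y' + 1) * (q * u\<^sup>2)" using pos unfolding y'_def by (simp add: dividend_less_div_times)
        then have "real N < real ((y' + 1) * (q * u\<^sup>2))" by (simp only: of_nat_less_iff)
        then have "real N / (real q * (real u)\<^sup>2) \<le> real y' + 1"
          using u assms by (subst pos_divide_le_eq) (auto simp: algebra_simps)
        then show ?thesis using u assms by (intro ln_mono) auto
      qed
      moreover have "ln (real N / (real u)\<^sup>2) = ln (real N / (real q * (real u)\<^sup>2)) + ln (real q)"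
        using u assms by (simp add: ln_div ln_mult)
      ultimately show ?thesis
        using harm_le_one_plus_ln[OF True] ln_le_harm[of y'] by linarith
    next
      case False
      then show ?thesis using yy assms by (simp add: harm_def)
    qed
    finally have "inverse (real u) * (\<Sum>e\<in>{e\<in>{1..N}. u\<^sup>2 * e \<le> N \<and> \<not> q * u\<^sup>2 * e \<le> N}. inverse (real e))
       \<le> inverse (real u) * (1 + ln (real q))" by (intro mult_left_mono) auto
    then show ?thesis by (simp add: sum_distrib_left divide_inverse)
  qed
  have "region 1 N - region q N = (SIGMA u:{1..N}. {e\<in>{1..N}. u\<^sup>2 * e \<le> N \<and> \<not> q * u\<^sup>2 * e \<le> N})"
    using assms by (auto simp: mem_region_iff)
  then have "(\<Sum>(u, e)\<in>region 1 N - region q N. 1 / (real u * real e)) =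
     (\<Sum>u=1..N. \<Sum>e\<in>{e\<in>{1..N}. u\<^sup>2 * e \<le> N \<and> \<not> q * u\<^sup>2 * e \<le> N}. 1 / (real u * real e))"
    by (simp add: sum.Sigma)
  also have "\<dots> \<le> (\<Sum>u=1..N. inverse (real u) * (1 + ln (real q)))"
    using inner by (rule sum_mono)
  also have "\<dots> = harm N * (1 + ln (real q))" by (simp add: harm_def sum_distrib_right)
  also have "\<dots> \<le> (1 + ln (real N)) * (1 + ln (real q))"
    using harm_le_one_plus_ln[OF assms(2)] assms by (intro mult_right_mono) auto
  finally show ?thesis .
qed

text \<open>The count is compared in turn with \<open>N / P\<close> times \<open>M\<close>,
  \<open>M1\<close>, \<open>T\<close> and \<open>L ^ 3 / 8\<close>: count the fibres, simplify the
  logarithm, enlarge the region, evaluate. In units of \<open>N / P * E\<close> these steps cost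
  \<open>7\<close>, \<open>ln P\<close>, \<open>1 + 2 * ln P\<close> and \<open>6\<close>. The
  dependence on \<open>P\<close> is explicit because the errors are later summed over all
  moduli.\<close>

lemma abs_card_quads_minus_le:
  assumes "\<alpha> \<ge> 1" "\<beta> \<ge> 1" "\<gamma> \<ge> 1" "\<delta> \<ge> 1" "N \<ge> 1"
  defines "P \<equiv> real (\<alpha> * \<beta> * \<gamma> * \<delta>)" and "L \<equiv> ln (real N)"
  shows "\<bar>real (card (quads \<alpha> \<beta> \<gamma> \<delta> N)) - real N / P * (L ^ 3 / 8)\<bar>
    \<le> real N / P * ((14 + 3 * ln P) * (1 + L)\<^sup>2)"
proof -
  define q where "q = \<alpha>\<^sup>2 * \<delta>"
  define E where "E = (1 + L)\<^sup>2"
  define M where "M = (\<Sum>(u, e)\<in>region q N. ln (max 1 (real N / (P * (real u * real e)))) / (real u * real e))"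
  define M1 where "M1 = (\<Sum>(u, e)\<in>region q N. ln (real N / (real u * real e)) / (real u * real e))"
  define T where "T = (\<Sum>(u, e)\<in>region 1 N. ln (real N / (real u * real e)) / (real u * real e))"
  have q: "q \<ge> 1" using assms by (simp add: q_def Suc_le_eq)
  have P: "P \<ge> 1"
  proof -
    have "1 \<le> \<alpha> * \<beta> * \<gamma> * \<delta>" using assms by (simp add: Suc_le_eq)
    then show ?thesis unfolding P_def by linarith
  qed
  have L: "0 \<le> L" using assms by simp
  have E: "0 \<le> E" by (simp add: E_def)
  have lnP: "0 \<le> ln P" using P by simp
  have NP: "0 \<le> real N / P" using P by simp
  have S1: "(\<Sum>(u, e)\<in>region q N. 1 / (real u * real e)) \<le> E"
    using sum_region_inverse_le[OF q assms(5)] by (simp add: E_def L_def)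

  have "\<bar>real (card (quads \<alpha> \<beta> \<gamma> \<delta> N)) - real N / P * M\<bar>
      = \<bar>\<Sum>(u, e)\<in>region q N. real (card (fibre (\<alpha> * u) (\<beta> * \<gamma>) (\<delta> * e) N))
           - real N / P * (ln (max 1 (real N / (P * (real u * real e)))) / (real u * real e))\<bar>"
    using assms by (simp add: card_quads q_def M_def sum_subtractf case_prod_unfold sum_distrib_left)
  also have "\<dots> \<le> (\<Sum>(u, e)\<in>region q N. 5 * (real N / P) * (1 / (real u * real e))
       + 2 * (real \<alpha> / (real \<beta> * real \<gamma>) * (1 + L)) * real u)"
  proof (rule order.trans[OF sum_abs], rule sum_mono, clarify)
    fix u e assume "(u, e) \<in> region q N"
    then have ue: "0 < u" "0 < e" "q * u\<^sup>2 * e \<le> N" by (auto simp: region_def)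
    have le: "(\<alpha> * u) * (\<alpha> * u) * (\<delta> * e) \<le> N"
      using ue(3) by (simp add: q_def power2_eq_square mult_ac)
    define V where "V = real N / (P * (real u * real e))"
    have V: "real N / (real (\<alpha> * u) * real (\<delta> * e)) / real (\<beta> * \<gamma>) = V"
      by (simp add: P_def V_def mult_ac)
    have "\<bar>real (card (fibre (\<alpha> * u) (\<beta> * \<gamma>) (\<delta> * e) N)) - V * ln (max 1 V)\<bar>
       \<le> 5 * V + 2 * (real (\<alpha> * u) / real (\<beta> * \<gamma>) * (1 + ln (real N)))"
      using abs_card_fibre_minus_le[of "\<alpha> * u" "\<beta> * \<gamma>" "\<delta> * e" N] assms(1-4) ue(1,2)
        le
      unfolding of_nat_mult[of "\<alpha> * u"] V by (simp add: Suc_le_eq)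
    moreover have "real N / P * (ln (max 1 V) / (real u * real e)) = V * ln (max 1 V)"
      by (simp add: V_def)
    moreover have "5 * (real N / P) * (1 / (real u * real e)) = 5 * V"
      by (simp add: V_def)
    moreover have "real (\<alpha> * u) / real (\<beta> * \<gamma>) * (1 + ln (real N)) = real \<alpha> / (real \<beta> * real \<gamma>) * (1 + L) * real u"
      by (simp add: L_def)
    ultimately show "\<bar>real (card (fibre (\<alpha> * u) (\<beta> * \<gamma>) (\<delta> * e) N))
           - real N / P * (ln (max 1 (real N / (P * (real u * real e)))) / (real u * real e))\<bar>
       \<le> 5 * (real N / P) * (1 / (real u * real e))
       + 2 * (real \<alpha> / (real \<beta> * real \<gamma>) * (1 + L)) * real u"
      unfolding V_def[symmetric] by linarith
  qed
  also have "\<dots> = 5 * (real N / P) * (\<Sum>(u, e)\<in>region q N. 1 / (real u * real e))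
       + 2 * (real \<alpha> / (real \<beta> * real \<gamma>) * (1 + L)) * (\<Sum>(u, e)\<in>region q N. real u)"
    by (simp only: case_prod_unfold sum.distrib sum_distrib_left)
  also have "\<dots> \<le> 5 * (real N / P) * E
       + 2 * (real \<alpha> / (real \<beta> * real \<gamma>) * (1 + L)) * (real N / real q * (1 + L))"
    using S1 NP L sum_region_fst_le[OF q assms(5)]
    by (intro add_mono mult_left_mono) (simp_all add: L_def)
  also have "\<dots> = real N / P * (7 * E)"
  proof -
    \<comment> \<open>From \<open>q = \<alpha>^2 \<delta>\<close> follows
      \<open>\<alpha> / (\<beta> \<gamma> q) = 1 / P\<close>, so this error has the same factor
      \<open>N / P\<close> as the main term.\<close>
    have "real \<alpha> / (real \<beta> * real \<gamma>) * (1 + L) * (real N / real q * (1 + L)) = real N / P * E"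
      using assms(1) by (simp add: P_def q_def E_def power2_eq_square mult_ac)
    then show ?thesis
      by (simp only: mult.assoc[of 2] mult.assoc[of 5] mult.left_commute[of _ 7]) simp
  qed
  finally have 1: "\<bar>real (card (quads \<alpha> \<beta> \<gamma> \<delta> N)) - real N / P * M\<bar> \<le> real N / P * (7 * E)" .

  \<comment> \<open>Removing \<open>P\<close> and the cut-off at 1 from the logarithm costs at most
    \<open>ln P\<close> per term, since \<open>N / (u e) \<ge> 1\<close> on the region.\<close>
  have "\<bar>M - M1\<bar> = \<bar>\<Sum>(u, e)\<in>region q N. (ln (max 1 (real N / (P * (real u * real e))))
      - ln (real N / (real u * real e))) * (1 / (real u * real e))\<bar>"
    by (simp add: M_def M1_def sum_subtractf case_prod_unfold diff_divide_distrib)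
  also have "\<dots> \<le> (\<Sum>(u, e)\<in>region q N. ln P * (1 / (real u * real e)))"
  proof (rule order.trans[OF sum_abs], rule sum_mono, clarify)
    fix u e assume "(u, e) \<in> region q N"
    then have ue: "0 < u" "0 < e" "q * u\<^sup>2 * e \<le> N" by (auto simp: region_def)
    define x where "x = real N / (real u * real e)"
    have x: "1 \<le> x"
    proof -
      have "u * e * 1 \<le> u * e * (q * u)" using ue q by (intro mult_le_mono2) (simp add: Suc_le_eq)
      also have "\<dots> = q * u\<^sup>2 * e" by (simp add: power2_eq_square mult_ac)
      finally have "u * e \<le> N" using ue by linarith
      then have "real (u * e) \<le> real N" by (simp only: of_nat_le_iff)
      then show ?thesis using ue by (simp add: x_def)
    qed
    have "ln (x / P) = ln x - ln P" using x P by (simp add: ln_div)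
    moreover have "ln (x / P) \<le> ln (max 1 (x / P))" using x P by (intro ln_mono) auto
    moreover have "ln (max 1 (x / P)) \<le> ln x"
      using x P frac_le[of x x 1 P] by (intro ln_mono) auto
    ultimately have "\<bar>ln (max 1 (x / P)) - ln x\<bar> \<le> ln P" using lnP by linarith
    moreover have eq: "real N / (P * (real u * real e)) = x / P" by (simp add: x_def mult.commute)
    ultimately show "\<bar>(ln (max 1 (real N / (P * (real u * real e))))
      - ln (real N / (real u * real e))) * (1 / (real u * real e))\<bar> \<le> ln P * (1 / (real u * real e))"
      unfolding abs_mult eq x_def[symmetric] by (intro mult_mono) auto
  qed
  also have "\<dots> = ln P * (\<Sum>(u, e)\<in>region q N. 1 / (real u * real e))"
    by (simp only: case_prod_unfold sum_distrib_left)
  also have "\<dots> \<le> ln P * E" using S1 lnP by (rule mult_left_mono)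
  finally have 2: "\<bar>M - M1\<bar> \<le> ln P * E" .

  have "T - M1 = (\<Sum>(u, e)\<in>region 1 N - region q N. ln (real N / (real u * real e)) / (real u * real e))"
    unfolding T_def M1_def using q
    by (intro sum_diff[symmetric] finite_region region_antimono) auto
  also have "\<bar>\<dots>\<bar> \<le> (\<Sum>(u, e)\<in>region 1 N - region q N. L * (1 / (real u * real e)))"
  proof (rule order.trans[OF sum_abs], rule sum_mono, clarify)
    fix u e assume "(u, e) \<in> region 1 N"
    then have ue: "0 < u" "0 < e" "u\<^sup>2 * e \<le> N" by (auto simp: region_def)
    have "u * e * 1 \<le> u * e * u" using ue by (intro mult_le_mono2) (simp add: Suc_le_eq)
    also have "\<dots> = u\<^sup>2 * e" by (simp add: power2_eq_square mult_ac)
    finally have "u * e \<le> N" using ue by linarith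
    then have "real (u * e) \<le> real N" by (simp only: of_nat_le_iff)
    then have "1 \<le> real N / (real u * real e)" using ue by simp
    moreover have "real N / (real u * real e) \<le> real N"
    proof -
      have "1 \<le> u * e" using ue by (simp add: Suc_le_eq)
      then have "1 \<le> real (u * e)" by linarith
      then show ?thesis using frac_le[of "real N" "real N" 1 "real (u * e)"] by simp
    qed
    ultimately have "0 \<le> ln (real N / (real u * real e))" "ln (real N / (real u * real e)) \<le> L"
      unfolding L_def by (auto intro: ln_mono)
    then show "\<bar>ln (real N / (real u * real e)) / (real u * real e)\<bar> \<le> L * (1 / (real u * real e))"
      by (simp add: divide_right_mono)
  qed
  also have "\<dots> = L * (\<Sum>(u, e)\<in>region 1 N - region q N. 1 / (real u * real e))"
    by (simp only: case_prod_unfold sum_distrib_left)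
  also have "\<dots> \<le> L * ((1 + L) * (1 + ln (real q)))"
    using sum_region_diff_inverse_le[OF q assms(5)] L unfolding L_def by (intro mult_left_mono)
  \<comment> \<open>\<open>\<alpha>^2 \<delta> \<le> P^2\<close> replaces \<open>ln q\<close> by
    \<open>2 * ln P\<close>, so the error depends on the moduli through \<open>P\<close>
    alone.\<close>
  also have "\<dots> \<le> (1 + L) * ((1 + L) * (1 + 2 * ln P))"
  proof -
    have "real q \<le> P\<^sup>2"
    proof -
      have "\<alpha>\<^sup>2 * \<delta> \<le> (\<alpha> * \<beta> * \<gamma> * \<delta>)\<^sup>2"
      proof -
        have "(\<alpha>\<^sup>2 * \<delta>) * 1 \<le> (\<alpha>\<^sup>2 * \<delta>) * (\<beta>\<^sup>2 * \<gamma>\<^sup>2 * \<delta>)"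
          using assms by (intro mult_le_mono2) (simp add: Suc_le_eq)
        then show ?thesis by (simp add: power2_eq_square mult_ac)
      qed
      then have "real q \<le> real ((\<alpha> * \<beta> * \<gamma> * \<delta>)\<^sup>2)" unfolding q_def of_nat_le_iff .
      then show ?thesis by (simp add: P_def)
    qed
    then have "ln (real q) \<le> ln (P\<^sup>2)" using q by (intro ln_mono) auto
    also have "ln (P\<^sup>2) = 2 * ln P" using P by (subst ln_realpow) auto
    finally have "ln (real q) \<le> 2 * ln P" .
    then show ?thesis using L lnP q by (intro mult_mono) auto
  qed
  also have "\<dots> = (1 + 2 * ln P) * E" by (simp add: E_def power2_eq_square)
  finally have 3: "\<bar>T - M1\<bar> \<le> (1 + 2 * ln P) * E" .

  have 4: "\<bar>T - L ^ 3 / 8\<bar> \<le> 6 * E"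
    using abs_region_sum_minus_le[OF assms(5)] by (simp add: T_def E_def L_def)
  have "\<bar>M - L ^ 3 / 8\<bar> \<le> ln P * E + (1 + 2 * ln P) * E + 6 * E"
    using 2 3 4 by linarith
  also have "\<dots> = (7 + 3 * ln P) * E" by (simp add: algebra_simps)
  finally have "\<bar>real N / P * (M - L ^ 3 / 8)\<bar> \<le> real N / P * ((7 + 3 * ln P) * E)"
    unfolding abs_mult using NP by (intro mult_mono) auto
  then have 5: "\<bar>real N / P * M - real N / P * (L ^ 3 / 8)\<bar> \<le> real N / P * ((7 + 3 * ln P) * E)"
    by (simp only: right_diff_distrib)
  have "\<bar>c - y\<bar> \<le> e1 + e2" if "\<bar>c - x\<bar> \<le> e1" "\<bar>x - y\<bar> \<le> e2" for c x y e1 e2 :: real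
    using that by linarith
  from this[OF 1 5]
  have "\<bar>real (card (quads \<alpha> \<beta> \<gamma> \<delta> N)) - real N / P * (L ^ 3 / 8)\<bar>
    \<le> real N / P * (7 * E) + real N / P * ((7 + 3 * ln P) * E)" .
  also have "\<dots> = real N / P * ((14 + 3 * ln P) * E)"
    by (simp only: distrib_left[symmetric] distrib_right[symmetric]) simp
  finally show ?thesis unfolding E_def .
qed


section \<open>Parametrising the solutions\<close>

definition quad_fibre :: "nat \<Rightarrow> nat \<Rightarrow> (nat \<times> nat \<times> nat) set" where
  "quad_fibre n a = {(u, v, e). 0 < u \<and> 0 < v \<and> 0 < e \<and> u * v * e = n \<and> coprime u v \<and> a dvd u + v}"

lemma egyptian_iff:
  assumes "n \<ge> 1" "x \<ge> 1" "y \<ge> 1"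
  shows "(of_nat a / of_nat n :: rat) = 1 / of_nat x + 1 / of_nat y \<longleftrightarrow> a * (x * y) = n * (x + y)"
proof -
  have "(of_nat a / of_nat n :: rat) = 1 / of_nat x + 1 / of_nat y
     \<longleftrightarrow> (of_nat a * (of_nat x * of_nat y) :: rat) = of_nat n * (of_nat x + of_nat y)"
    using assms by (simp add: divide_simps) (auto simp: algebra_simps)
  also have "\<dots> \<longleftrightarrow> (of_nat (a * (x * y)) :: rat) = of_nat (n * (x + y))"
    by simp
  also have "\<dots> \<longleftrightarrow> a * (x * y) = n * (x + y)"
    by (rule of_nat_eq_iff)
  finally show ?thesis .
qed

lemma coprime_mult_add:
  fixes u v :: nat
  assumes "coprime u v"
  shows "coprime (u * v) (u + v)"
  using assms by (metis coprime_mult_left_iff coprime_commute gcd_add1 gcd_add2 coprime_iff_gcd_eq_1)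

text \<open>With \<open>d = gcd x y\<close>, \<open>x = u d\<close>, \<open>y = v d\<close>, the
  equation reads \<open>a d u v = n (u + v)\<close>. As \<open>u v\<close> is coprime to
  \<open>u + v\<close>, it divides \<open>n\<close>; call the cofactor \<open>e\<close>. Then
  \<open>a d = e (u + v)\<close>, and \<open>a\<close> divides \<open>u + v\<close> because it is
  coprime to \<open>e\<close>. Hence \<open>d = g e\<close> with \<open>g = (u + v) / a\<close>,
  which dictates the map \<open>f\<close>.\<close>

lemma R_eq_card_quad_fibre:
  assumes n: "n \<ge> 1" and a: "a \<ge> 1" and na: "coprime n a"
  shows "R n a = card (quad_fibre n a)"
proof -
  define X where "X = {(x, y). x \<ge> 1 \<and> y \<ge> 1 \<and> (of_nat a / of_nat n :: rat) = 1 / of_nat x + 1 / of_nat y}"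
  have X_iff: "(x, y) \<in> X \<longleftrightarrow> x \<ge> 1 \<and> y \<ge> 1 \<and> a * (x * y) = n * (x + y)" for x y
    unfolding X_def using egyptian_iff[OF n, of x y a] by auto
  define f where "f = (\<lambda>(u, v, e). ((u + v) div a * e * u, (u + v) div a * e * v))"
  have "bij_betw f (quad_fibre n a) X"
  proof (rule bij_betwI')
    fix s t assume "s \<in> quad_fibre n a" "t \<in> quad_fibre n a"
    then obtain u v e u' v' e' where s: "s = (u, v, e)" and t: "t = (u', v', e')"
      and s': "0 < u" "0 < v" "0 < e" "coprime u v" "a dvd u + v"
      and t': "0 < u'" "0 < v'" "0 < e'" "coprime u' v'" "a dvd u' + v'"
      by (auto simp: quad_fibre_def)
    obtain g where g: "u + v = a * g" using s' by (elim dvdE)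
    obtain g' where g': "u' + v' = a * g'" using t' by (elim dvdE)
    have pos: "0 < g" "0 < g'" using g g' s' t' by (auto intro!: Nat.gr0I)
    have div: "(u + v) div a = g" "(u' + v') div a = g'" using g g' a by simp_all
    have "s = t" if "f s = f t"
    proof -
      have eq: "g * e * u = g' * e' * u'" "g * e * v = g' * e' * v'"
        using that by (simp_all add: f_def s t div)
      \<comment> \<open>The gcd of the image pair is \<open>g * e\<close>, as \<open>u\<close> and
        \<open>v\<close> are coprime. Dividing by it recovers \<open>u\<close> and \<open>v\<close>,
        their sum gives \<open>g\<close>, and then \<open>e\<close> follows.\<close>
      have "gcd (g * e * u) (g * e * v) = g * e" "gcd (g' * e' * u') (g' * e' * v') = g' * e'"
        using s' t' by (simp_all add: gcd_mult_distrib_nat[symmetric])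
      then have ge: "g * e = g' * e'" using eq by simp
      then have uv: "u = u'" "v = v'" using eq pos s' t' by auto
      then have "g = g'" using g g' a by simp
      then show ?thesis using ge uv pos by (simp add: s t)
    qed
    then show "(f s = f t) = (s = t)" by blast
  next
    fix s assume "s \<in> quad_fibre n a"
    then obtain u v e where s: "s = (u, v, e)"
      and s': "0 < u" "0 < v" "0 < e" "u * v * e = n" "coprime u v" "a dvd u + v"
      by (auto simp: quad_fibre_def)
    obtain g where g: "u + v = a * g" using s' by (elim dvdE)
    have pos: "0 < g" using g s' by (auto intro!: Nat.gr0I)
    have div: "(u + v) div a = g" using g a by simp
    have "n * (g * e * u + g * e * v) = u * v * e * (g * e * (u + v))"
      by (simp add: s'(4) distrib_left)
    also have "\<dots> = a * ((g * e * u) * (g * e * v))" by (simp add: g mult_ac)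
    finally have "(g * e * u, g * e * v) \<in> X"
      unfolding X_iff using pos s' by (simp add: Suc_le_eq)
    then show "f s \<in> X" by (simp add: f_def s div)
  next
    fix z assume "z \<in> X"
    then obtain x y where z: "z = (x, y)" and xy: "x \<ge> 1" "y \<ge> 1" "a * (x * y) = n * (x + y)"
      using X_iff by (cases z) auto
    define d where "d = gcd x y"
    have d: "0 < d" using xy by (simp add: d_def)
    obtain u v where uv: "x = u * d" "y = v * d" "coprime u v"
      using gcd_coprime_exists[of x y] d unfolding d_def by auto
    have pos: "0 < u" "0 < v" using uv xy by (auto intro!: Nat.gr0I)
    have "d * (a * d * (u * v)) = d * (n * (u + v))"
      using xy(3) by (simp add: uv algebra_simps)
    then have 1: "a * d * (u * v) = n * (u + v)" using d by simp
    then have "u * v dvd n * (u + v)" by (metis dvd_triv_right)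
    then have "u * v dvd n"
      using coprime_mult_add[OF uv(3)] by (simp add: coprime_dvd_mult_left_iff)
    then obtain e where e: "n = u * v * e" by (elim dvdE)
    have e0: "0 < e" using e n by (auto intro!: Nat.gr0I)
    have "(u * v) * (a * d) = (u * v) * (e * (u + v))" using 1 e by (simp add: mult_ac)
    then have 2: "a * d = e * (u + v)" using pos by simp
    \<comment> \<open>Here \<open>a / n\<close> being in lowest terms enters: \<open>e\<close>
      divides \<open>n\<close>, so \<open>a\<close> must divide the other factor
      \<open>u + v\<close>.\<close>
    have "coprime e a" using na e by simp
    moreover have "a dvd e * (u + v)" using 2 by (metis dvd_triv_left)
    ultimately have adv: "a dvd u + v" by (simp add: coprime_commute coprime_dvd_mult_right_iff)
    then obtain g where g: "u + v = a * g" by (elim dvdE)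
    have "a * d = a * (g * e)" using 2 g by (simp add: mult_ac)
    then have "d = g * e" using a by simp
    then have "z = f (u, v, e)" using a by (simp add: f_def z uv g mult_ac)
    moreover have "(u, v, e) \<in> quad_fibre n a"
      using pos e0 e uv adv by (simp add: quad_fibre_def)
    ultimately show "\<exists>s\<in>quad_fibre n a. z = f s" by blast
  qed
  then have "card (quad_fibre n a) = card X" by (rule bij_betw_same_card)
  then show ?thesis by (simp add: R_def X_def)
qed

lemma le_of_mult_le:
  fixes u v e N :: nat
  assumes "0 < u" "0 < v" "0 < e" "u * v * e \<le> N"
  shows "u \<le> N" "v \<le> N" "e \<le> N"
proof -
  have "0 < u * v * e" using assms by simp
  moreover have "u dvd u * v * e" "v dvd u * v * e" "e dvd u * v * e" by simp_all
  ultimately have "u \<le> u * v * e" "v \<le> u * v * e" "e \<le> u * v * e"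
    by (blast intro: dvd_imp_le)+
  then show "u \<le> N" "v \<le> N" "e \<le> N"
    using assms(4) by linarith+
qed

section \<open>Reduction of \<open>U\<close> to a count of quadruples\<close>

definition coprime_quads :: "nat \<Rightarrow> nat \<Rightarrow> (nat \<times> nat \<times> nat) set" where
  "coprime_quads N a = {(u, v, e). 0 < u \<and> 0 < v \<and> 0 < e \<and> u * v * e \<le> N \<and> coprime u v \<and> a dvd u + v \<and> coprime a e}"

lemma finite_coprime_quads: "finite (coprime_quads N a)"
proof (rule finite_subset)
  show "coprime_quads N a \<subseteq> {..N} \<times> {..N} \<times> {..N}"
  proof
    fix z assume "z \<in> coprime_quads N a"
    then obtain u v e where "z = (u, v, e)" "0 < u" "0 < v" "0 < e" "u * v * e \<le> N"
      by (auto simp: coprime_quads_def)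
    with le_of_mult_le[of u v e N] show "z \<in> {..N} \<times> {..N} \<times> {..N}" by simp
  qed
qed simp

text \<open>Since \<open>a\<close> divides \<open>u + v\<close>, which is coprime to
  \<open>u v\<close>, the product \<open>u v e\<close> is coprime to \<open>a\<close> exactly when
  \<open>e\<close> is. The solution sets for the various \<open>n\<close> therefore partition a set
  described without \<open>n\<close>.\<close>

lemma S_eq_card_coprime_quads:
  assumes "a \<ge> 1"
  shows "S N a = card (coprime_quads N a)"
proof -
  define I where "I = {n. 1 \<le> n \<and> n \<le> N \<and> coprime n a}"
  have I: "finite I" by (rule finite_subset[of _ "{..N}"]) (auto simp: I_def)
  have "coprime_quads N a = (\<Union>n\<in>I. quad_fibre n a)"
  proof -
    have "(u, v, e) \<in> coprime_quads N a \<longleftrightarrow> (u, v, e) \<in> (\<Union>n\<in>I. quad_fibre n a)" for u v e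
    proof -
      have "(u, v, e) \<in> (\<Union>n\<in>I. quad_fibre n a) \<longleftrightarrow> u * v * e \<in> I \<and> (u, v, e) \<in> quad_fibre (u * v * e) a"
        by (auto simp: quad_fibre_def)
      moreover have "coprime (u * v * e) a \<longleftrightarrow> coprime a e" if "coprime u v" "a dvd u + v"
      proof -
        have "coprime (u * v) a"
          using coprime_mult_add[OF that(1)] that(2) by (meson coprime_divisors dvd_refl)
        then show ?thesis unfolding coprime_mult_left_iff[of "u * v"] by (simp add: coprime_commute)
      qed
      ultimately show ?thesis
        unfolding coprime_quads_def quad_fibre_def I_def mem_Collect_eq prod.case
        by (auto simp: Suc_le_eq simp del: coprime_mult_left_iff)
    qed
    then show ?thesis by auto
  qed
  moreover have "finite (quad_fibre n a)" if "n \<in> I" for n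
  proof (rule finite_subset)
    show "quad_fibre n a \<subseteq> coprime_quads N a" using that calculation by blast
  qed (rule finite_coprime_quads)
  ultimately have "card (coprime_quads N a) = (\<Sum>n\<in>I. card (quad_fibre n a))"
    using I by (simp only:, intro card_UN_disjoint) (auto simp: quad_fibre_def)
  also have "\<dots> = (\<Sum>n\<in>I. R n a)"
    using assms by (intro sum.cong) (auto simp: I_def R_eq_card_quad_fibre)
  finally show ?thesis by (simp add: S_def I_def)
qed

text \<open>The cut-off at \<open>2 * N\<close> makes finiteness evident and loses nothing, as
  \<open>a\<close> divides \<open>u + v\<close>, which is at most \<open>2 * N\<close>.\<close>

definition all_quads :: "nat \<Rightarrow> (nat \<times> nat \<times> nat \<times> nat) set" where
  "all_quads N = (SIGMA a:{1..2 * N}. coprime_quads N a)"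

lemma coprime_quads_imp_le:
  assumes "(u, v, e) \<in> coprime_quads N a"
  shows "a \<le> 2 * N"
proof -
  have h: "0 < u" "0 < v" "0 < e" "u * v * e \<le> N" "a dvd u + v"
    using assms by (auto simp: coprime_quads_def)
  have "a \<le> u + v" using h by (intro dvd_imp_le) auto
  then show ?thesis using le_of_mult_le[OF h(1-4)] by linarith
qed

lemma mem_all_quads_iff:
  "(a, u, v, e) \<in> all_quads N \<longleftrightarrow> 0 < a \<and> 0 < u \<and> 0 < v \<and> 0 < e \<and> u * v * e \<le> N \<and>
     coprime u v \<and> a dvd u + v \<and> coprime a e"
proof -
  have "(a, u, v, e) \<in> all_quads N \<longleftrightarrow> 0 < a \<and> (u, v, e) \<in> coprime_quads N a"
    using coprime_quads_imp_le[of u v e N a] by (auto simp: all_quads_def)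
  then show ?thesis by (simp add: coprime_quads_def)
qed

lemma U_eq_card_all_quads: "U N = real (card (all_quads N))"
proof -
  have "S N a = 0" if "a \<in> {1..} - {1..2 * N}" for a
  proof -
    have "coprime_quads N a = {}"
      using that coprime_quads_imp_le[of _ _ _ N a] by auto
    then show ?thesis using that by (simp add: S_eq_card_coprime_quads)
  qed
  then have "U N = infsum (\<lambda>a. real (S N a)) {1..2 * N}"
    unfolding U_def by (intro infsum_cong_neutral) auto
  also have "\<dots> = real (\<Sum>a=1..2 * N. card (coprime_quads N a))"
    by (simp add: S_eq_card_coprime_quads)
  also have "(\<Sum>a=1..2 * N. card (coprime_quads N a)) = card (all_quads N)"
    unfolding all_quads_def by (subst card_SigmaI) (auto simp: finite_coprime_quads)
  finally show ?thesis .
qed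

text \<open>With \<open>v = a * b - u\<close>, coprimality of \<open>u\<close> and \<open>v\<close>
  is coprimality of \<open>u\<close> and \<open>a * b\<close>. It is split over the two factors so
  that each condition concerns a pair of free variables and inclusion-exclusion yields divisibility
  of single variables.\<close>

definition ordered_quads :: "nat \<Rightarrow> ((nat \<times> nat) \<times> (nat \<times> nat)) set" where
  "ordered_quads N = {((u, e), (a, b)) \<in> quads 1 1 1 1 N. coprime u a \<and> coprime u b \<and> coprime a e}"

lemma finite_all_quads: "finite (all_quads N)"
  by (simp add: all_quads_def finite_coprime_quads)

text \<open>Swapping \<open>u\<close> and \<open>v\<close> accounts for the factor 2. On the
  diagonal, coprimality forces \<open>u = v = 1\<close>, so \<open>a\<close> divides 2 and
  \<open>e \<le> N\<close>, which gives at most \<open>2 * N\<close> quadruples.\<close>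

lemma abs_U_minus_le: "\<bar>U N - 2 * real (card (ordered_quads N))\<bar> \<le> 2 * real N"
proof -
  define W where "W = (\<lambda>P. {(a, u, v, e) \<in> all_quads N. P u v})"
  have fin: "finite (W P)" for P
    by (rule finite_subset[OF _ finite_all_quads[of N]]) (auto simp: W_def)
  have split: "all_quads N = (W (<) \<union> W (\<lambda>u v. v < u)) \<union> W (=)"
    by (auto simp: W_def)
  have "W (<) \<inter> W (\<lambda>u v. v < u) = {}" "(W (<) \<union> W (\<lambda>u v. v < u)) \<inter> W (=) = {}"
    by (auto simp: W_def)
  then have "card (all_quads N) = card (W (<)) + card (W (\<lambda>u v. v < u)) + card (W (=))"
    unfolding split using fin by (simp add: card_Un_disjoint)
  moreover have "card (W (\<lambda>u v. v < u)) = card (W (<))"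
  proof (rule bij_betw_same_card, rule bij_betw_byWitness)
    let ?s = "\<lambda>(a, u, v, e). (a, v, u, e :: nat)"
    show "?s ` W (\<lambda>u v. v < u) \<subseteq> W (<)" "?s ` W (<) \<subseteq> W (\<lambda>u v. v < u)"
      by (auto simp: W_def mem_all_quads_iff mult_ac coprime_commute add.commute)
  qed auto
  moreover have "card (W (=)) \<le> 2 * N"
  proof -
    have "W (=) \<subseteq> (\<lambda>(a, e). (a, 1, 1, e)) ` ({1..2} \<times> {1..N})"
      by (auto simp: W_def mem_all_quads_iff image_iff Suc_le_eq dest: dvd_imp_le)
    then have "card (W (=)) \<le> card ((\<lambda>(a, e). (a, 1 :: nat, 1 :: nat, e)) ` ({1..2 :: nat} \<times> {1..N}))"
      by (intro card_mono) auto
    also have "\<dots> \<le> card ({1..2 :: nat} \<times> {1..N})" by (intro card_image_le) auto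
    finally show ?thesis by simp
  qed
  moreover have "card (W (<)) = card (ordered_quads N)"
  proof (rule bij_betw_same_card[symmetric], rule bij_betw_byWitness)
    let ?f = "\<lambda>((u, e), (a, b)). (a, u, a * b - u, e :: nat)"
    let ?g = "\<lambda>(a, u, v, e :: nat). ((u, e), (a, (u + v) div a))"
    show "\<forall>z\<in>ordered_quads N. ?g (?f z) = z" by (auto simp: ordered_quads_def quads_def)
    show "\<forall>z\<in>W (<). ?f (?g z) = z" by (auto simp: W_def mem_all_quads_iff)
    show "?f ` ordered_quads N \<subseteq> W (<)"
    proof clarify
      fix u e a b assume "((u, e), (a, b)) \<in> ordered_quads N"
      then have h: "0 < u" "0 < e" "0 < a" "0 < b" "2 * u < a * b" "u * (a * b - u) * e \<le> N"
        "coprime u a" "coprime u b" "coprime a e"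
        by (auto simp: ordered_quads_def quads_def)
      have "coprime u (u + (a * b - u)) \<longleftrightarrow> coprime u (a * b - u)"
        by (simp add: coprime_iff_gcd_eq_1)
      then have "coprime u (a * b - u)" using h by simp
      then show "(a, u, a * b - u, e) \<in> W (<)"
        using h by (simp add: W_def mem_all_quads_iff)
    qed
    show "?g ` W (<) \<subseteq> ordered_quads N"
    proof clarify
      fix a u v e assume "(a, u, v, e) \<in> W (<)"
      then have h: "u < v" "0 < a" "0 < u" "0 < v" "0 < e" "u * v * e \<le> N" "coprime u v" "a dvd u + v" "coprime a e"
        by (auto simp: W_def mem_all_quads_iff)
      obtain b where b: "u + v = a * b" using h by (elim dvdE)
      have "coprime u (u + v)" using h by (simp add: coprime_iff_gcd_eq_1)
      moreover have "0 < b" using b h by (auto intro!: Nat.gr0I)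
      moreover have "a * b - u = v" "2 * u < a * b" using h by (simp_all flip: b)
      ultimately show "((u, e), (a, (u + v) div a)) \<in> ordered_quads N"
        using h by (simp add: ordered_quads_def quads_def b)
    qed
  qed
  ultimately show ?thesis unfolding U_eq_card_all_quads by linarith
qed


section \<open>Inclusion-exclusion over sets of primes\<close>

lemma sum_Pow_insert:
  fixes h :: "'a set \<Rightarrow> 'b::comm_monoid_add"
  assumes "finite A" "x \<notin> A"
  shows "(\<Sum>X\<in>Pow (insert x A). h X) = (\<Sum>X\<in>Pow A. h X + h (insert x X))"
proof -
  have "inj_on (insert x) (Pow A)" using assms by (auto simp: inj_on_def)
  moreover have "Pow A \<inter> insert x ` Pow A = {}" using assms by auto
  ultimately show ?thesis
    using assms by (simp add: Pow_insert sum.union_disjoint sum.reindex sum.distrib)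
qed

text \<open>Each \<open>p\<close> lies in \<open>X\<close>, \<open>Y\<close>, \<open>Z\<close>
  independently, giving eight local terms: 1 for none; \<open>- f p ^ 2\<close> for each single set;
  \<open>f p ^ 3\<close> for \<open>X, Y\<close> and for \<open>X, Z\<close>; \<open>f p ^ 4\<close>
  for \<open>Y, Z\<close>; and \<open>- f p ^ 4\<close> for all three. The fourth powers cancel,
  leaving the Euler factor.\<close>

lemma sum_triple_Pow_eq_prod:
  fixes f :: "'a \<Rightarrow> real"
  assumes "finite A"
  shows "(\<Sum>X\<in>Pow A. \<Sum>Y\<in>Pow A. \<Sum>Z\<in>Pow A. (-1) ^ (card X + card Y + card Z) *
      (prod f (X \<union> Y) * prod f (X \<union> Z) * prod f Y * prod f Z))
    = (\<Prod>p\<in>A. 1 - 3 * f p ^ 2 + 2 * f p ^ 3)"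
  using assms
proof (induction A rule: finite_induct)
  case (insert p A)
  define w where "w = (\<lambda>X Y Z. (-1) ^ (card X + card Y + card Z) *
      (prod f (X \<union> Y) * prod f (X \<union> Z) * prod f Y * prod f Z))"
  have w: "w X Y Z + w X Y (insert p Z) + (w X (insert p Y) Z + w X (insert p Y) (insert p Z))
      + (w (insert p X) Y Z + w (insert p X) Y (insert p Z)
      + (w (insert p X) (insert p Y) Z + w (insert p X) (insert p Y) (insert p Z)))
      = (1 - 3 * f p ^ 2 + 2 * f p ^ 3) * w X Y Z"
    if "X \<subseteq> A" "Y \<subseteq> A" "Z \<subseteq> A" for X Y Z
  proof -
    have fin: "finite X" "finite Y" "finite Z"
      using that insert.hyps by (auto intro: finite_subset)
    have notin: "p \<notin> X" "p \<notin> Y" "p \<notin> Z" using that insert.hyps by auto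
    show ?thesis
      using fin notin
      by (simp add: w_def power_add algebra_simps power2_eq_square power3_eq_cube)
  qed
  have "(\<Sum>X\<in>Pow (insert p A). \<Sum>Y\<in>Pow (insert p A). \<Sum>Z\<in>Pow (insert p A). w X Y Z)
     = (\<Sum>X\<in>Pow A. \<Sum>Y\<in>Pow A. \<Sum>Z\<in>Pow A. (1 - 3 * f p ^ 2 + 2 * f p ^ 3) * w X Y Z)"
    unfolding sum_Pow_insert[OF insert.hyps] sum.distrib[symmetric]
    by (intro sum.cong refl w) auto
  also have "\<dots> = (1 - 3 * f p ^ 2 + 2 * f p ^ 3) * (\<Sum>X\<in>Pow A. \<Sum>Y\<in>Pow A. \<Sum>Z\<in>Pow A. w X Y Z)"
    by (simp add: sum_distrib_left)
  also have "(\<Sum>X\<in>Pow A. \<Sum>Y\<in>Pow A. \<Sum>Z\<in>Pow A. w X Y Z) = (\<Prod>p\<in>A. 1 - 3 * f p ^ 2 + 2 * f p ^ 3)"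
    unfolding w_def by (rule insert.IH)
  finally show ?case using insert.hyps by (simp add: w_def)
qed simp

lemma prod_primes_dvd_iff:
  fixes m :: nat
  assumes "finite A" "\<And>p. p \<in> A \<Longrightarrow> prime p"
  shows "\<Prod>A dvd m \<longleftrightarrow> (\<forall>p\<in>A. p dvd m)"
  using assms
proof (induction A rule: finite_induct)
  case (insert p A)
  have "coprime p (\<Prod>A)"
    using insert by (intro prod_coprime_right) (metis insertCI primes_coprime)
  then have "p * \<Prod>A dvd m \<longleftrightarrow> p dvd m \<and> \<Prod>A dvd m"
    by (metis divides_mult dvd_mult_left dvd_mult_right)
  then show ?case using insert by simp
qed simp

definition primes_le :: "nat \<Rightarrow> nat set" where
  "primes_le M = {p. prime p \<and> p \<le> M}"

lemma finite_primes_le: "finite (primes_le M)"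
  by (rule finite_subset[of _ "{..M}"]) (auto simp: primes_le_def)

text \<open>Moebius inversion with squarefree numbers encoded as sets of primes: expand the product
  of \<open>1 - of_bool (p dvd m \<and> p dvd n)\<close>. The primes up to \<open>M\<close> suffice,
  because a common prime factor is at most \<open>m\<close>.\<close>

lemma coprime_indicator_eq:
  fixes m n M :: nat
  assumes "0 < m" "m \<le> M"
  shows "(of_bool (coprime m n) :: real) =
    (\<Sum>X\<in>Pow (primes_le M). (-1) ^ card X * of_bool (\<forall>p\<in>X. p dvd m \<and> p dvd n))"
proof -
  have "(of_bool (coprime m n) :: real) = (\<Prod>p\<in>primes_le M. 1 - of_bool (p dvd m \<and> p dvd n))"
  proof (cases "coprime m n")
    case True
    have "\<not> (p dvd m \<and> p dvd n)" if "p \<in> primes_le M" for p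
      using True that by (auto simp: primes_le_def dest: coprime_common_divisor_nat)
    then have "(\<Prod>p\<in>primes_le M. 1 - of_bool (p dvd m \<and> p dvd n) :: real) = 1"
      by (intro prod.neutral ballI) simp
    then show ?thesis using True by simp
  next
    case False
    then obtain p where p: "prime p" "p dvd m" "p dvd n"
      using prime_factor_nat[of "gcd m n"] by (auto simp: coprime_iff_gcd_eq_1)
    then have "p \<in> primes_le M" using assms dvd_imp_le[of p m] by (auto simp: primes_le_def)
    then have "(\<Prod>p\<in>primes_le M. 1 - of_bool (p dvd m \<and> p dvd n) :: real) = 0"
      using p finite_primes_le by (auto simp: prod_zero_iff)
    then show ?thesis using False by simp
  qed
  also have "\<dots> = (\<Sum>X\<in>Pow (primes_le M). (-1) ^ card X * (\<Prod>p\<in>X. of_bool (p dvd m \<and> p dvd n)))"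
    by (simp add: prod_diff_conv_sum finite_primes_le)
  also have "\<dots> = (\<Sum>X\<in>Pow (primes_le M). (-1) ^ card X * of_bool (\<forall>p\<in>X. p dvd m \<and> p dvd n))"
  proof (intro sum.cong refl arg_cong2[of _ _ _ _ "(*)"])
    fix X assume "X \<in> Pow (primes_le M)"
    then have "finite X" by (auto intro: finite_subset finite_primes_le)
    then show "(\<Prod>p\<in>X. of_bool (p dvd m \<and> p dvd n) :: real) = of_bool (\<forall>p\<in>X. p dvd m \<and> p dvd n)"
      by (induction X rule: finite_induct) auto
  qed
  finally show ?thesis .
qed

lemma quads_bounds:
  assumes "((u, e), (a, b)) \<in> quads 1 1 1 1 N"
  shows "0 < u" "u \<le> 2 * N" "0 < a" "a \<le> 2 * N" "e \<le> 2 * N" "b \<le> 2 * N"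
proof -
  have h: "0 < u" "0 < a * b - u" "0 < e" "u * (a * b - u) * e \<le> N" "0 < a" "0 < b" "2 * u < a * b"
    using assms by (auto simp: quads_def)
  note le = le_of_mult_le[OF h(1-4)]
  have "a * b \<le> 2 * N" using le h by linarith
  moreover have "a \<le> a * b" "b \<le> a * b" using h by simp_all
  ultimately show "0 < u" "u \<le> 2 * N" "0 < a" "a \<le> 2 * N" "e \<le> 2 * N" "b \<le> 2 * N"
    using h le by linarith+
qed

lemma finite_quads: "finite (quads 1 1 1 1 N)"
proof (rule finite_subset)
  show "quads 1 1 1 1 N \<subseteq> ({..2 * N} \<times> {..2 * N}) \<times> ({..2 * N} \<times> {..2 * N})"
  proof
    fix z assume "z \<in> quads 1 1 1 1 N"
    then obtain u e a b where "z = ((u, e), (a, b))" "((u, e), (a, b)) \<in> quads 1 1 1 1 N"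
      by (cases z) auto
    then show "z \<in> ({..2 * N} \<times> {..2 * N}) \<times> ({..2 * N} \<times> {..2 * N})"
      using quads_bounds by simp
  qed
qed simp

text \<open>\<open>X\<close>, \<open>Y\<close>, \<open>Z\<close> belong to the pairs
  \<open>(u, a)\<close>, \<open>(u, b)\<close>, \<open>(a, e)\<close>. A prime required of
  \<open>u\<close> by both \<open>X\<close> and \<open>Y\<close> counts once, so the modulus is the
  product over the union. The range \<open>2 * N\<close> works since \<open>u\<close> and
  \<open>a\<close> are bounded by it.\<close>

lemma card_ordered_quads:
  fixes N :: nat
  defines "Q \<equiv> Pow (primes_le (2 * N))"
  shows "real (card (ordered_quads N)) =
    (\<Sum>X\<in>Q. \<Sum>Y\<in>Q. \<Sum>Z\<in>Q. (-1) ^ (card X + card Y + card Z) *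
       real (card (quads (\<Prod>(X \<union> Y)) (\<Prod>(X \<union> Z)) (\<Prod>Y) (\<Prod>Z) N)))"
proof -
  define B where "B = quads 1 1 1 1 N"
  define i where "i = (\<lambda>X (m :: nat) n. of_bool (\<forall>p\<in>X. p dvd m \<and> p dvd n) :: real)"
  have B: "finite B" unfolding B_def by (rule finite_quads)
  have finQ: "finite X" "\<And>p. p \<in> X \<Longrightarrow> prime p" if "X \<in> Q" for X
    using that finite_primes_le[of "2 * N"] by (auto simp: Q_def primes_le_def intro: finite_subset)
  have "real (card (ordered_quads N)) =
      (\<Sum>((u, e), (a, b))\<in>B. of_bool (coprime u a) * of_bool (coprime u b) * of_bool (coprime a e))"
  proof -
    have "ordered_quads N = {z \<in> B. case z of ((u, e), (a, b)) \<Rightarrow> coprime u a \<and> coprime u b \<and> coprime a e}"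
      by (auto simp: ordered_quads_def B_def)
    then have "real (card (ordered_quads N)) =
        (\<Sum>z\<in>B. of_bool (case z of ((u, e), (a, b)) \<Rightarrow> coprime u a \<and> coprime u b \<and> coprime a e))"
      using B by (simp add: sum_of_bool_eq Int_def)
    also have "\<dots> = (\<Sum>((u, e), (a, b))\<in>B. of_bool (coprime u a) * of_bool (coprime u b) * of_bool (coprime a e))"
      by (intro sum.cong) (auto split: prod.splits)
    finally show ?thesis .
  qed
  also have "\<dots> = (\<Sum>((u, e), (a, b))\<in>B.
      (\<Sum>X\<in>Q. (-1) ^ card X * i X u a) * (\<Sum>Y\<in>Q. (-1) ^ card Y * i Y u b) * (\<Sum>Z\<in>Q. (-1) ^ card Z * i Z a e))"
  proof (intro sum.cong refl, clarify)
    fix u e a b assume "((u, e), (a, b)) \<in> B"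
    then have "0 < u" "u \<le> 2 * N" "0 < a" "a \<le> 2 * N"
      unfolding B_def by (rule quads_bounds)+
    then show "of_bool (coprime u a) * of_bool (coprime u b) * of_bool (coprime a e) =
      (\<Sum>X\<in>Q. (-1) ^ card X * i X u a) * (\<Sum>Y\<in>Q. (-1) ^ card Y * i Y u b) * (\<Sum>Z\<in>Q. (-1) ^ card Z * i Z a e)"
      unfolding Q_def i_def by (simp only: coprime_indicator_eq[symmetric])
  qed
  also have "\<dots> = (\<Sum>((u, e), (a, b))\<in>B. \<Sum>X\<in>Q. \<Sum>Y\<in>Q. \<Sum>Z\<in>Q.
      (-1) ^ (card X + card Y + card Z) * (i X u a * i Y u b * i Z a e))"
    unfolding sum_product sum_distrib_right
    by (simp add: sum_distrib_left sum_distrib_right power_add mult_ac)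
  also have "\<dots> = (\<Sum>X\<in>Q. \<Sum>Y\<in>Q. \<Sum>Z\<in>Q. \<Sum>((u, e), (a, b))\<in>B.
      (-1) ^ (card X + card Y + card Z) * (i X u a * i Y u b * i Z a e))"
    unfolding case_prod_unfold
    by (subst sum.swap, intro sum.cong refl, subst sum.swap, intro sum.cong refl, subst sum.swap, rule refl)
  also have "\<dots> = (\<Sum>X\<in>Q. \<Sum>Y\<in>Q. \<Sum>Z\<in>Q. (-1) ^ (card X + card Y + card Z) *
       real (card (quads (\<Prod>(X \<union> Y)) (\<Prod>(X \<union> Z)) (\<Prod>Y) (\<Prod>Z) N)))"
  proof (intro sum.cong refl)
    fix X Y Z assume XYZ: "X \<in> Q" "Y \<in> Q" "Z \<in> Q"
    note fin = finQ[OF XYZ(1)] finQ[OF XYZ(2)] finQ[OF XYZ(3)]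
    have dvd: "\<Prod>(X \<union> Y) dvd m \<longleftrightarrow> (\<forall>p\<in>X. p dvd m) \<and> (\<forall>p\<in>Y. p dvd m)"
      "\<Prod>(X \<union> Z) dvd m \<longleftrightarrow> (\<forall>p\<in>X. p dvd m) \<and> (\<forall>p\<in>Z. p dvd m)"
      "\<Prod>Y dvd m \<longleftrightarrow> (\<forall>p\<in>Y. p dvd m)" "\<Prod>Z dvd m \<longleftrightarrow> (\<forall>p\<in>Z. p dvd m)" for m
      using fin by (subst prod_primes_dvd_iff; blast)+
    have "quads (\<Prod>(X \<union> Y)) (\<Prod>(X \<union> Z)) (\<Prod>Y) (\<Prod>Z) N =
       {z \<in> B. case z of ((u, e), (a, b)) \<Rightarrow>
         (\<forall>p\<in>X. p dvd u \<and> p dvd a) \<and> (\<forall>p\<in>Y. p dvd u \<and> p dvd b) \<and> (\<forall>p\<in>Z. p dvd a \<and> p dvd e)}"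
      unfolding B_def quads_def dvd by auto
    then have "real (card (quads (\<Prod>(X \<union> Y)) (\<Prod>(X \<union> Z)) (\<Prod>Y) (\<Prod>Z) N)) =
       (\<Sum>z\<in>B. of_bool (case z of ((u, e), (a, b)) \<Rightarrow>
         (\<forall>p\<in>X. p dvd u \<and> p dvd a) \<and> (\<forall>p\<in>Y. p dvd u \<and> p dvd b) \<and> (\<forall>p\<in>Z. p dvd a \<and> p dvd e)))"
      using B by (simp add: sum_of_bool_eq Int_def)
    also have "\<dots> = (\<Sum>((u, e), (a, b))\<in>B. i X u a * i Y u b * i Z a e)"
      by (intro sum.cong) (auto simp: i_def)
    finally show "(\<Sum>((u, e), (a, b))\<in>B. (-1) ^ (card X + card Y + card Z) * (i X u a * i Y u b * i Z a e))
      = (-1) ^ (card X + card Y + card Z) * real (card (quads (\<Prod>(X \<union> Y)) (\<Prod>(X \<union> Z)) (\<Prod>Y) (\<Prod>Z) N))"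
      by (simp only: sum_distrib_left case_prod_unfold)
  qed
  finally show ?thesis .
qed


section \<open>Error terms and the Euler product\<close>

lemma ln_le_powr_eighth:
  assumes "x \<ge> (1::real)"
  shows "ln x \<le> 8 * x powr (1 / 8)"
proof -
  have "ln x = 8 * ln (x powr (1 / 8))" using assms by (simp add: ln_powr)
  also have "ln (x powr (1 / 8)) \<le> x powr (1 / 8)"
    using assms ln_le_minus_one[of "x powr (1 / 8)"] by simp
  finally show ?thesis by simp
qed

text \<open>With \<open>P \<ge> D powr (4 / 3)\<close>, the exponent is \<open>7 / 6 = 7 / 8 * (4 / 3)\<close>: a factor \<open>P powr (1 / 8)\<close> is
  spent on the logarithm, and the remaining exponent still exceeds 1.\<close>

lemma error_weight_le:
  assumes "P \<ge> (1::real)" "D \<ge> 1" "D ^ 4 \<le> P ^ 3"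
  shows "(14 + 3 * ln P) / P \<le> 38 * D powr (- 7 / 6)"
proof -
  have "1 \<le> P powr (1 / 8)" using assms by (intro ge_one_powr_ge_zero) auto
  then have "14 + 3 * ln P \<le> 38 * P powr (1 / 8)"
    using ln_le_powr_eighth[OF assms(1)] by linarith
  then have "(14 + 3 * ln P) / P \<le> 38 * P powr (1 / 8) / P powr 1"
    using assms by (simp add: divide_right_mono)
  also have "\<dots> = 38 * P powr (1 / 8 - 1)" by (simp only: powr_diff times_divide_eq_right)
  also have "\<dots> = 38 * P powr (- 7 / 8)" by simp
  also have "P powr (- 7 / 8) = (P ^ 3) powr (- 7 / 24)"
    using assms by (simp add: powr_powr flip: powr_numeral)
  also have "\<dots> \<le> (D ^ 4) powr (- 7 / 24)"
    using assms by (intro powr_mono2') auto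
  also have "(D ^ 4) powr (- 7 / 24) = D powr (- 7 / 6)"
    using assms by (simp add: powr_powr flip: powr_numeral)
  finally show ?thesis by simp
qed

text \<open>The sum is the expansion of the product of \<open>1 + g p\<close>, and each factor is at
  most \<open>exp (g p)\<close>. The bound does not depend on \<open>A\<close>, which gives
  uniformity in the set of primes.\<close>

lemma sum_Pow_prod_le_exp:
  fixes g :: "nat \<Rightarrow> real"
  assumes "finite A" "\<And>n. 0 \<le> g n" "summable g"
  shows "(\<Sum>X\<in>Pow A. prod g X) \<le> exp (suminf g)"
proof -
  have "(\<Sum>X\<in>Pow A. prod g X) = (\<Prod>p\<in>A. g p + 1)"
    using prod_add[OF assms(1), of g "\<lambda>_. 1"] by simp
  also have "\<dots> \<le> (\<Prod>p\<in>A. exp (g p))"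
    using assms(2) by (intro prod_mono) (auto simp: add.commute intro: add_nonneg_nonneg)
  also have "\<dots> = exp (\<Sum>p\<in>A. g p)" using assms(1) by (simp add: exp_sum)
  also have "\<dots> \<le> exp (suminf g)" using assms by (simp add: sum_le_suminf)
  finally show ?thesis .
qed

text \<open>The unions couple the three sets. Bounding the weight by a power of
  \<open>\<Prod>X * \<Prod>Y * \<Prod>Z\<close> decouples them, and the sum factors into three sums
  over sets of primes, each controlled by the convergent series of
  \<open>n powr (- 7 / 6)\<close>.\<close>

lemma sum_error_weights_le:
  obtains K where "0 \<le> K" "\<And>M. (\<Sum>X\<in>Pow (primes_le M). \<Sum>Y\<in>Pow (primes_le M). \<Sum>Z\<in>Pow (primes_le M).
      (14 + 3 * ln (real (\<Prod>(X \<union> Y) * \<Prod>(X \<union> Z) * \<Prod>Y * \<Prod>Z))) / real (\<Prod>(X \<union> Y) * \<Prod>(X \<union> Z) * \<Prod>Y * \<Prod>Z)) \<le> K"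
proof
  define g where "g = (\<lambda>n. real n powr (- 7 / 6))"
  define K where "K = 38 * (exp (suminf g) * exp (suminf g) * exp (suminf g))"
  show "0 \<le> K" by (simp add: K_def)
  fix M
  define Q where "Q = Pow (primes_le M)"
  have g: "summable g" unfolding g_def by (simp add: summable_real_powr_iff)
  have S: "0 \<le> (\<Sum>X\<in>Q. prod g X)" "(\<Sum>X\<in>Q. prod g X) \<le> exp (suminf g)"
    unfolding Q_def using g by (auto simp: g_def finite_primes_le intro!: sum_Pow_prod_le_exp sum_nonneg prod_nonneg)
  have "(\<Sum>X\<in>Q. \<Sum>Y\<in>Q. \<Sum>Z\<in>Q.
      (14 + 3 * ln (real (\<Prod>(X \<union> Y) * \<Prod>(X \<union> Z) * \<Prod>Y * \<Prod>Z))) / real (\<Prod>(X \<union> Y) * \<Prod>(X \<union> Z) * \<Prod>Y * \<Prod>Z))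
     \<le> (\<Sum>X\<in>Q. \<Sum>Y\<in>Q. \<Sum>Z\<in>Q. 38 * (prod g X * prod g Y * prod g Z))"
  proof (intro sum_mono)
    fix X Y Z assume XYZ: "X \<in> Q" "Y \<in> Q" "Z \<in> Q"
    have fin: "finite X" "finite Y" "finite Z"
      using XYZ finite_primes_le[of M] by (auto simp: Q_def intro: finite_subset)
    have pos: "p \<ge> 1" if "p \<in> X \<union> Y \<union> Z" for p
    proof (rule prime_ge_1_nat)
      show "prime p" using that XYZ by (auto simp: Q_def primes_le_def)
    qed
    have ge1: "\<Prod>W \<ge> 1" if "W \<subseteq> X \<union> Y \<union> Z" for W :: "nat set"
      using that pos by (intro prod_ge_1) auto
    have mono: "\<Prod>W \<le> \<Prod>W'" if "W \<subseteq> W'" "W' \<subseteq> X \<union> Y \<union> Z" for W W' :: "nat set"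
    proof (rule dvd_imp_le)
      have "finite W'" using that fin by (auto intro: finite_subset)
      then show "\<Prod>W dvd \<Prod>W'" using that by (intro prod_dvd_prod_subset)
      show "0 < \<Prod>W'" using ge1[OF that(2)] by linarith
    qed
    define x where "x = \<Prod>X" define y where "y = \<Prod>Y" define z where "z = \<Prod>Z"
    define \<alpha> where "\<alpha> = \<Prod>(X \<union> Y)" define \<beta> where "\<beta> = \<Prod>(X \<union> Z)"
    have ge: "x \<ge> 1" "y \<ge> 1" "z \<ge> 1" "\<alpha> \<ge> 1" "\<beta> \<ge> 1"
      unfolding x_def y_def z_def \<alpha>_def \<beta>_def by (rule ge1; blast)+
    have le: "x \<le> \<alpha>" "y \<le> \<alpha>" "x \<le> \<beta>" "z \<le> \<beta>"
      unfolding x_def y_def z_def \<alpha>_def \<beta>_def by (rule mono; blast)+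
    \<comment> \<open>\<open>\<alpha>\<close> dominates \<open>x\<close> and \<open>y\<close>, while
      \<open>\<beta>\<close> dominates \<open>x\<close> and \<open>z\<close>. Spending
      \<open>\<alpha>^3\<close> on \<open>x x y\<close> and \<open>\<beta>^3\<close> on
      \<open>x x z\<close> balances the exponents: with \<open>y^3 z^3\<close> the result is exactly
      \<open>(x y z)^4\<close>.\<close>
    have "(x * x * y) * (x * x * z) \<le> (\<alpha> * \<alpha> * \<alpha>) * (\<beta> * \<beta> * \<beta>)"
      using le by (intro mult_le_mono)
    then have "(x * x * y) * (x * x * z) * (y * y * y * (z * z * z)) \<le> (\<alpha> * \<alpha> * \<alpha>) * (\<beta> * \<beta> * \<beta>) * (y * y * y * (z * z * z))"
      by (rule mult_le_mono1)
    moreover have "(x * y * z) ^ 4 = (x * x * y) * (x * x * z) * (y * y * y * (z * z * z))"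
      by (simp add: power4_eq_xxxx mult_ac)
    moreover have "(\<alpha> * \<beta> * y * z) ^ 3 = (\<alpha> * \<alpha> * \<alpha>) * (\<beta> * \<beta> * \<beta>) * (y * y * y * (z * z * z))"
      by (simp add: power3_eq_cube mult_ac)
    ultimately have "(x * y * z) ^ 4 \<le> (\<alpha> * \<beta> * y * z) ^ 3" by linarith
    then have "real ((x * y * z) ^ 4) \<le> real ((\<alpha> * \<beta> * y * z) ^ 3)" by (simp only: of_nat_le_iff)
    then have pow: "real (x * y * z) ^ 4 \<le> real (\<alpha> * \<beta> * y * z) ^ 3" by (simp only: of_nat_power)
    have "1 \<le> x * y * z" "1 \<le> \<alpha> * \<beta> * y * z" using ge by (simp_all add: Suc_le_eq)
    then have "1 \<le> real (x * y * z)" "1 \<le> real (\<alpha> * \<beta> * y * z)" by linarith+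
    from error_weight_le[OF this(2,1) pow]
    have "(14 + 3 * ln (real (\<alpha> * \<beta> * y * z))) / real (\<alpha> * \<beta> * y * z) \<le> 38 * real (x * y * z) powr (- 7 / 6)" .
    also have "real (x * y * z) powr (- 7 / 6) = g x * g y * g z"
      by (simp add: g_def powr_mult)
    also have "g x * g y * g z = prod g X * prod g Y * prod g Z"
      unfolding g_def x_def y_def z_def of_nat_prod by (simp_all add: prod_powr_distrib)
    finally show "(14 + 3 * ln (real (\<Prod>(X \<union> Y) * \<Prod>(X \<union> Z) * \<Prod>Y * \<Prod>Z))) / real (\<Prod>(X \<union> Y) * \<Prod>(X \<union> Z) * \<Prod>Y * \<Prod>Z)
      \<le> 38 * (prod g X * prod g Y * prod g Z)"
      unfolding x_def y_def z_def \<alpha>_def \<beta>_def .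
  qed
  also have "\<dots> = 38 * ((\<Sum>X\<in>Q. prod g X) * (\<Sum>X\<in>Q. prod g X) * (\<Sum>X\<in>Q. prod g X))"
    by (simp only: sum_distrib_left sum_distrib_right mult_ac)
  also have "\<dots> \<le> K"
    unfolding K_def using S by (intro mult_left_mono mult_mono mult_nonneg_nonneg) auto
  finally show "(\<Sum>X\<in>Pow (primes_le M). \<Sum>Y\<in>Pow (primes_le M). \<Sum>Z\<in>Pow (primes_le M).
      (14 + 3 * ln (real (\<Prod>(X \<union> Y) * \<Prod>(X \<union> Z) * \<Prod>Y * \<Prod>Z))) / real (\<Prod>(X \<union> Y) * \<Prod>(X \<union> Z) * \<Prod>Y * \<Prod>Z)) \<le> K"
    unfolding Q_def .
qed

section \<open>Truncation of the Euler product\<close>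

lemma sum_inverse_square_le:
  assumes "1 \<le> m" "m \<le> n"
  shows "(\<Sum>k\<in>{m<..n}. 3 / real k ^ 2) \<le> 3 / real m - 3 / real n"
  using assms(2)
proof (induction n rule: dec_induct)
  case (step n)
  have n: "1 \<le> real n" using step assms by simp
  have "{m<..Suc n} = insert (Suc n) {m<..n}" using step by auto
  moreover have "3 / (1 + real n) ^ 2 \<le> 3 / real n - 3 / (1 + real n)"
  proof -
    have "3 / real n - 3 / (1 + real n) = 3 / (real n * (1 + real n))"
      using n by (simp add: field_simps)
    moreover have "3 / (1 + real n) ^ 2 \<le> 3 / (real n * (1 + real n))"
    proof (rule frac_le)
      show "real n * (1 + real n) \<le> (1 + real n) ^ 2" by (simp add: power2_eq_square)
      show "0 < real n * (1 + real n)" using n by simp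
    qed auto
    ultimately show ?thesis by linarith
  qed
  ultimately show ?case using step by simp
qed simp

text \<open>All factors \<open>1 - h p\<close> lie between 0 and 1, so a longer partial product
  differs from a shorter one by at most the sum of the additional \<open>h p\<close> (Weierstrass
  inequality). That tail is bounded by \<open>3 / m\<close> uniformly, and the bound passes to the
  limit.\<close>

lemma abs_partial_prod_minus_C_const_le:
  assumes "m \<ge> 1"
  shows "\<bar>(\<Prod>p\<in>primes_le m. 1 - 3 * (1 / real p) ^ 2 + 2 * (1 / real p) ^ 3) - C_const\<bar> \<le> 3 / real m"
proof -
  define h where "h = (\<lambda>p::nat. if prime p then 3 / real p ^ 2 - 2 / real p ^ 3 else 0)"
  have h: "0 \<le> h p" "h p \<le> 3 / real p ^ 2" "h p \<le> 1" for p
  proof -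
    show "0 \<le> h p"
    proof (cases "prime p")
      case True
      then have "2 \<le> real p" using prime_ge_2_nat[of p] by linarith
      then have "2 / real p ^ 3 \<le> 3 / real p ^ 2"
        by (simp add: field_simps power2_eq_square power3_eq_cube)
      then show ?thesis using True by (simp add: h_def)
    qed (simp add: h_def)
    show h2: "h p \<le> 3 / real p ^ 2" by (simp add: h_def)
    show "h p \<le> 1"
    proof (cases "prime p")
      case True
      then have p: "2 \<le> real p" using prime_ge_2_nat[of p] by linarith
      then have "2 * 2 \<le> real p * real p" by (intro mult_mono) auto
      then have "3 / real p ^ 2 \<le> 1" using p by (simp add: power2_eq_square)
      then show ?thesis using h2 by linarith
    qed (simp add: h_def)
  qed
  define f where "f = (\<lambda>p. 1 - h p)"
  have f_eq: "f = (\<lambda>p. if prime p then 1 - 3 / real p ^ 2 + 2 / real p ^ 3 else 1)"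
    by (auto simp: f_def h_def)
  have "summable (\<lambda>p. 3 * inverse (real p ^ 2))"
    by (intro summable_mult inverse_power_summable) auto
  \<comment> \<open>Absolute convergence guarantees that \<open>C_const\<close> is the limit of the
    partial products.\<close>
  then have "summable (\<lambda>p. norm (f p - 1))"
    using h by (elim summable_comparison_test'[where N = 0]) (simp add: f_def divide_inverse)
  then have "convergent_prod f"
    by (intro abs_convergent_prod_imp_convergent_prod summable_imp_abs_convergent_prod)
  then have lim: "(\<lambda>n. \<Prod>i\<le>n. f i) \<longlonglongrightarrow> C_const"
    unfolding C_const_def f_eq[symmetric] by (rule convergent_prod_LIMSEQ)
  have partial: "(\<Prod>p\<in>primes_le m. 1 - 3 * (1 / real p) ^ 2 + 2 * (1 / real p) ^ 3) = (\<Prod>i\<le>m. f i)"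
  proof (rule prod.mono_neutral_cong_left)
    show "\<forall>i\<in>{..m} - primes_le m. f i = 1" by (auto simp: primes_le_def f_eq)
  qed (auto simp: primes_le_def f_eq power_divide)
  have bound: "\<bar>(\<Prod>i\<le>m. f i) - (\<Prod>i\<le>n. f i)\<bar> \<le> 3 / real m" if "n \<ge> m" for n
  proof -
    have P01: "0 \<le> prod f W" "prod f W \<le> 1" for W
      using h by (auto simp: f_def intro!: prod_nonneg prod_le_1)
    have "{..n} = {..m} \<union> {m<..n}" using that by auto
    then have "(\<Prod>i\<le>n. f i) = (\<Prod>i\<le>m. f i) * (\<Prod>i\<in>{m<..n}. f i)"
      by (simp only:) (intro prod.union_disjoint, auto)
    then have "(\<Prod>i\<le>m. f i) - (\<Prod>i\<le>n. f i) = (\<Prod>i\<le>m. f i) * (1 - (\<Prod>i\<in>{m<..n}. f i))"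
      by (simp add: algebra_simps)
    also have "\<bar>\<dots>\<bar> \<le> 1 * (1 - (\<Prod>i\<in>{m<..n}. f i))"
      unfolding abs_mult using P01 by (intro mult_mono) auto
    also have "\<dots> \<le> sum h {m<..n}"
      using Weierstrass_prod_ineq[of "{m<..n}" h] h by (simp add: f_def)
    also have "\<dots> \<le> (\<Sum>k\<in>{m<..n}. 3 / real k ^ 2)"
      using h by (intro sum_mono) auto
    also have "\<dots> \<le> 3 / real m - 3 / real n"
      using assms that by (rule sum_inverse_square_le)
    also have "\<dots> \<le> 3 / real m" by simp
    finally show ?thesis .
  qed
  have "(\<lambda>n. \<bar>(\<Prod>i\<le>m. f i) - (\<Prod>i\<le>n. f i)\<bar>) \<longlonglongrightarrow> \<bar>(\<Prod>i\<le>m. f i) - C_const\<bar>"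
    by (intro tendsto_intros lim)
  then have "\<bar>(\<Prod>i\<le>m. f i) - C_const\<bar> \<le> 3 / real m"
    by (rule LIMSEQ_le_const2) (use bound in blast)
  then show ?thesis unfolding partial .
qed

section \<open>Assembling the asymptotic formula\<close>

lemma abs_card_ordered_quads_minus_le:
  obtains K where "0 \<le> K" "\<And>N. N \<ge> 1 \<Longrightarrow>
    \<bar>real (card (ordered_quads N)) - C_const / 8 * real N * ln (real N) ^ 3\<bar> \<le> K * real N * (1 + ln (real N))\<^sup>2"
proof -
  obtain K where K: "0 \<le> K" "\<And>M. (\<Sum>X\<in>Pow (primes_le M). \<Sum>Y\<in>Pow (primes_le M). \<Sum>Z\<in>Pow (primes_le M).
      (14 + 3 * ln (real (\<Prod>(X \<union> Y) * \<Prod>(X \<union> Z) * \<Prod>Y * \<Prod>Z))) / real (\<Prod>(X \<union> Y) * \<Prod>(X \<union> Z) * \<Prod>Y * \<Prod>Z)) \<le> K"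
    using sum_error_weights_le by blast
  have "\<bar>real (card (ordered_quads N)) - C_const / 8 * real N * ln (real N) ^ 3\<bar>
      \<le> (K + 1) * real N * (1 + ln (real N))\<^sup>2" if N: "N \<ge> 1" for N
  proof -
    define Q where "Q = Pow (primes_le (2 * N))"
    define L where "L = ln (real N)"
    define s where "s = (\<lambda>(X :: nat set) (Y :: nat set) (Z :: nat set). (-1) ^ (card X + card Y + card Z) :: real)"
    define P where "P = (\<lambda>X Y Z. real (\<Prod>(X \<union> Y) * \<Prod>(X \<union> Z) * \<Prod>Y * \<Prod>Z))"
    define c where "c = (\<lambda>X Y Z. real (card (quads (\<Prod>(X \<union> Y)) (\<Prod>(X \<union> Z)) (\<Prod>Y) (\<Prod>Z) N)))"
    define CN where "CN = (\<Prod>p\<in>primes_le (2 * N). 1 - 3 * (1 / real p) ^ 2 + 2 * (1 / real p) ^ 3)"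
    have L: "0 \<le> L" "L \<le> real N" using N ln_le_minus_one[of "real N"] by (simp_all add: L_def)
    have pow: "0 \<le> L\<^sup>2" "L\<^sup>2 \<le> (1 + L)\<^sup>2" using L by (simp_all add: power_mono)
    \<comment> \<open>The main terms are all multiples of \<open>1 / P X Y Z\<close>, so their
      signed sum is the Euler product over the primes up to \<open>2 * N\<close>.\<close>
    have euler: "(\<Sum>X\<in>Q. \<Sum>Y\<in>Q. \<Sum>Z\<in>Q. s X Y Z * (1 / P X Y Z)) = CN"
      unfolding CN_def Q_def
      using sum_triple_Pow_eq_prod[OF finite_primes_le[of "2 * N"], of "\<lambda>p. 1 / real p"]
      by (simp add: s_def P_def prod_dividef of_nat_prod)
    have card: "real (card (ordered_quads N)) = (\<Sum>X\<in>Q. \<Sum>Y\<in>Q. \<Sum>Z\<in>Q. s X Y Z * c X Y Z)"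
      by (simp only: card_ordered_quads Q_def s_def c_def)
    have "real (card (ordered_quads N)) - real N * (L ^ 3 / 8) * CN
        = (\<Sum>X\<in>Q. \<Sum>Y\<in>Q. \<Sum>Z\<in>Q. s X Y Z * c X Y Z) - real N * (L ^ 3 / 8) * (\<Sum>X\<in>Q. \<Sum>Y\<in>Q. \<Sum>Z\<in>Q. s X Y Z * (1 / P X Y Z))"
      unfolding euler card ..
    also have "\<dots> = (\<Sum>X\<in>Q. \<Sum>Y\<in>Q. \<Sum>Z\<in>Q. s X Y Z * (c X Y Z - real N / P X Y Z * (L ^ 3 / 8)))"
      unfolding sum_distrib_left sum_subtractf[symmetric]
      by (intro sum.cong refl) (simp add: right_diff_distrib mult_ac)
    also have "\<bar>\<dots>\<bar> \<le> (\<Sum>X\<in>Q. \<Sum>Y\<in>Q. \<Sum>Z\<in>Q. \<bar>s X Y Z * (c X Y Z - real N / P X Y Z * (L ^ 3 / 8))\<bar>)"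
      by (intro order.trans[OF sum_abs] sum_mono order.refl)
    also have "\<dots> \<le> (\<Sum>X\<in>Q. \<Sum>Y\<in>Q. \<Sum>Z\<in>Q. real N * (1 + L)\<^sup>2 * ((14 + 3 * ln (P X Y Z)) / P X Y Z))"
    proof (intro sum_mono)
      fix X Y Z assume XYZ: "X \<in> Q" "Y \<in> Q" "Z \<in> Q"
      have pos: "p \<ge> 1" if "p \<in> X \<union> Y \<union> Z" for p
      proof (rule prime_ge_1_nat)
        show "prime p" using that XYZ by (auto simp: Q_def primes_le_def)
      qed
      have "\<Prod>(X \<union> Y) \<ge> 1" "\<Prod>(X \<union> Z) \<ge> 1" "\<Prod>Y \<ge> 1" "\<Prod>Z \<ge> 1"
        using pos by (intro prod_ge_1; blast)+
      from abs_card_quads_minus_le[OF this N]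
      have "\<bar>c X Y Z - real N / P X Y Z * (L ^ 3 / 8)\<bar> \<le> real N / P X Y Z * ((14 + 3 * ln (P X Y Z)) * (1 + L)\<^sup>2)"
        unfolding c_def P_def L_def .
      moreover have "\<bar>s X Y Z\<bar> = 1" by (simp add: s_def power_abs)
      ultimately show "\<bar>s X Y Z * (c X Y Z - real N / P X Y Z * (L ^ 3 / 8))\<bar>
          \<le> real N * (1 + L)\<^sup>2 * ((14 + 3 * ln (P X Y Z)) / P X Y Z)"
        by (simp add: abs_mult mult_ac)
    qed
    also have "\<dots> = real N * (1 + L)\<^sup>2 * (\<Sum>X\<in>Q. \<Sum>Y\<in>Q. \<Sum>Z\<in>Q. (14 + 3 * ln (P X Y Z)) / P X Y Z)"
      by (simp only: sum_distrib_left)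
    also have "\<dots> \<le> real N * (1 + L)\<^sup>2 * K"
      unfolding P_def Q_def by (intro mult_left_mono K) simp
    finally have 1: "\<bar>real (card (ordered_quads N)) - real N * (L ^ 3 / 8) * CN\<bar> \<le> real N * (1 + L)\<^sup>2 * K" .
    \<comment> \<open>Completing the product costs \<open>O(1 / N)\<close>; against
      \<open>N L^3\<close> this leaves \<open>O(L^3)\<close>, absorbed through
      \<open>L \<le> N\<close>. It accounts for the extra 1 in the constant
      \<open>K + 1\<close>.\<close>
    have "\<bar>CN - C_const\<bar> \<le> 3 / real (2 * N)"
      unfolding CN_def using N by (intro abs_partial_prod_minus_C_const_le) simp
    then have "\<bar>real N * (L ^ 3 / 8) * (CN - C_const)\<bar> \<le> real N * (L ^ 3 / 8) * (3 / real (2 * N))"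
      unfolding abs_mult using L by (intro mult_mono) auto
    also have "\<dots> = L ^ 3 * (3 / 16)" using N by simp
    also have "\<dots> \<le> L ^ 3 * 1" using L by (intro mult_left_mono) auto
    also have "\<dots> = L * L\<^sup>2" by (simp add: power2_eq_square power3_eq_cube)
    also have "\<dots> \<le> real N * (1 + L)\<^sup>2" using L pow by (intro mult_mono) auto
    finally have 2: "\<bar>real N * (L ^ 3 / 8) * CN - real N * (L ^ 3 / 8) * C_const\<bar> \<le> real N * (1 + L)\<^sup>2"
      by (simp only: right_diff_distrib)
    have "\<bar>x - z\<bar> \<le> e1 + e2" if "\<bar>x - y\<bar> \<le> e1" "\<bar>y - z\<bar> \<le> e2" for x y z e1 e2 :: real
      using that by linarith
    from this[OF 1 2]
    have "\<bar>real (card (ordered_quads N)) - real N * (L ^ 3 / 8) * C_const\<bar> \<le> real N * (1 + L)\<^sup>2 * K + real N * (1 + L)\<^sup>2" .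
    also have "real N * (L ^ 3 / 8) * C_const = C_const / 8 * real N * L ^ 3" by simp
    also have "real N * (1 + L)\<^sup>2 * K + real N * (1 + L)\<^sup>2 = (K + 1) * real N * (1 + L)\<^sup>2"
      by (simp add: distrib_left distrib_right mult_ac)
    finally show ?thesis unfolding L_def .
  qed
  then show ?thesis using that[of "K + 1"] K by simp
qed

theorem theorem2:
  shows "\<exists>K. \<forall>N::nat. N \<ge> 2 \<longrightarrow>
    \<bar>U N - C_const / 4 * real N * (ln (real N)) ^ 3\<bar> \<le> K * real N * (ln (real N)) ^ 2"
proof -
  obtain K where K: "0 \<le> K" "\<And>N. N \<ge> 1 \<Longrightarrow>
    \<bar>real (card (ordered_quads N)) - C_const / 8 * real N * ln (real N) ^ 3\<bar> \<le> K * real N * (1 + ln (real N))\<^sup>2"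
    using abs_card_ordered_quads_minus_le by blast
  have "\<bar>U N - C_const / 4 * real N * ln (real N) ^ 3\<bar> \<le> (2 * K + 2) * 9 * real N * ln (real N) ^ 2"
    if N: "N \<ge> 2" for N
  proof -
    define L where "L = ln (real N)"
    have "ln 2 \<le> L" unfolding L_def using N by (intro ln_mono) auto
    \<comment> \<open>For \<open>N \<ge> 2\<close> this gives \<open>1 + L \<le> 3 * L\<close>,
      which turns the error into a multiple of \<open>L^2\<close> and explains the factor 9.\<close>
    then have L: "1 / 2 \<le> L" using ln2_ge_two_thirds by linarith
    then have sq: "(1 + L)\<^sup>2 \<le> (3 * L)\<^sup>2" by (intro power_mono) auto
    have one: "1 \<le> (1 + L)\<^sup>2" using L by (simp add: one_le_power)
    \<comment> \<open>Doubling the ordered count gives \<open>C_const / 4\<close> and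
      \<open>2 * K\<close>; the summand \<open>2 * real N\<close> comes from the diagonal.\<close>
    have "\<bar>U N - 2 * (C_const / 8 * real N * L ^ 3)\<bar> \<le> 2 * real N + 2 * (K * real N * (1 + L)\<^sup>2)"
      using abs_U_minus_le[of N] K(2)[of N] N unfolding L_def by linarith
    also have "\<dots> \<le> 2 * (real N * (1 + L)\<^sup>2) + 2 * (K * real N * (1 + L)\<^sup>2)"
      using mult_left_mono[OF one, of "real N"] by simp
    also have "\<dots> = (2 * K + 2) * real N * (1 + L)\<^sup>2" by (simp add: algebra_simps)
    also have "\<dots> \<le> (2 * K + 2) * real N * (3 * L)\<^sup>2" using sq K by (intro mult_left_mono) auto
    also have "\<dots> = (2 * K + 2) * 9 * real N * L\<^sup>2" by (simp add: power_mult_distrib)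
    also have "2 * (C_const / 8 * real N * L ^ 3) = C_const / 4 * real N * L ^ 3" by simp
    finally show ?thesis unfolding L_def .
  qed
  then show ?thesis by blast
qed

end
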